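(* Let $I(\boldsymbol{B},\boldsymbol{r})$ be a blockwise determinantal ideal with $\boldsymbol{B}=(B_1,\dots,B_k)$ and $\boldsymbol{r}=(r_1,\dots,r_k)$, let $\mathcal{G}_i$ be the set of all $r_i$-minors in $B_i$ for $i=1,\dots,k$, and let $<$ be a lexicographic diagonal term order induced by a scanning variable order. If the blocks $B_1,\dots,B_k$ are one-sided ladders which share the same unique upper corner, and for any lower corners $x_{a_ib_i}$ of $B_i$ and $x_{\tilde a_j\tilde b_j}$ of $B_j$ with $i\ne j$ neither ($a_i>\tilde a_j$ and $b_i>\tilde b_j$) nor ($a_i<\tilde a_j$ and $b_i<\tilde b_j$) holds, then $\bigcup_{i=1}^k\mathcal{G}_i$ is a Gröbner basis of $I(\boldsymbol{B},\boldsymbol{r})$ with respect to $<$.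
   Context: Let $K$ be a field and $X=(x_{ij})$ a generic $m\times n$ matrix ($m\le n$) of distinct variables; $K[\boldsymbol{x}]$ is the polynomial ring in all $mn$ variables. A subset of $X$ means a set of entries. An $r$-minor of $X$ is the determinant of an $r\times r$ submatrix (arbitrary row and column index sets of size $r$); it is a minor in a subset $B$ if all entries of the submatrix belong to $B$. For a sequence $\boldsymbol{B}=(B_1,\dots,B_k)$ of non-empty subsets of $X$ (blocks) and a sequence $\boldsymbol{r}=(r_1,\dots,r_k)$ of positive integers, the blockwise determinantal ideal $I(\boldsymbol{B},\boldsymbol{r})\subseteq K[\boldsymbol{x}]$ is generated by all $r_i$-minors in $B_i$ for all $i$. A one-sided ladder with unique upper corner $x_{cd}$ and lower corners $x_{a_1b_1},\dots,x_{a_\ell b_\ell}$, where $1\le a_1<\cdots<a_\ell\le m$, $n\ge b_1\ge\cdots\ge b_\ell\ge1$ and the corners are entries of the ladder (so $c\le a_s$, $d\le b_s$ for all $s$), is the set $\{x_{pq}:\exists\, s\text{ with }c\le p\le a_s,\ d\le q\le b_s\}$. (Such a set is diagonal: if it contains the northwest and southeast corner entries of a contiguous submatrix it contains the whole submatrix.) The scanning variable orders inducing lexicographic diagonal term orders are the four orders in which either the northwest corner $x_{11}$ is the greatest variable and the next greatest variables are determined by scanning row by row to the east (rows top to bottom) or column by column to the south (columns left to right), or the southeast corner $x_{mn}$ is the greatest and one scans row by row to the west (rows bottom to top) or column by column to the north (columns right to left). For such a term order the leading term of every minor is the product of its diagonal entries. It is a known fact, taken as given, that for each $i$ the set $\mathcal{G}_i$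 is a Gröbner basis of the ideal it generates with respect to such an order. *)

theory Defs
  imports
    "HOL-Algebra.Ideal"
    "Jordan_Normal_Form.Determinant"
    "Jordan_Normal_Form.DL_Submatrix"
    "HOL-Library.Poly_Mapping"
begin

text \<open>
  A variable is identified with its position in the matrix. Positions are counted from 0, as in
  \<^typ>\<open>'a mat\<close>, so that \<open>(i, j)\<close> stands for the variable conventionally written
  \<open>x\<close> with indices \<open>i + 1\<close> and \<open>j + 1\<close>, and a set of entries of
  the generic matrix is a set of positions.
\<close>

type_synonym pos = "nat \<times> nat"
type_synonym monomial = "pos \<Rightarrow>\<^sub>0 nat"
type_synonym 'a mpoly = "monomial \<Rightarrow>\<^sub>0 'a"

definition entries :: "nat \<Rightarrow> nat \<Rightarrow> pos set" where
  "entries m n = {..<m} \<times> {..<n}"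

text \<open>The type \<open>'a mpoly\<close> has infinitely many variables; the carrier of the
  polynomial ring below restricts them to the \<open>m * n\<close> entries of the matrix.\<close>

definition poly_ring :: "nat \<Rightarrow> nat \<Rightarrow> 'a::field mpoly ring" where
  "poly_ring m n =
     \<lparr>carrier = {p. \<forall>t\<in>Poly_Mapping.keys p. Poly_Mapping.keys t \<subseteq> entries m n},
      monoid.mult = (*), monoid.one = 1, ring.zero = 0, ring.add = (+)\<rparr>"

lemma cring_poly_ring: "cring (poly_ring m n :: 'a::field mpoly ring)"
proof -
  let ?C = "carrier (poly_ring m n :: 'a mpoly ring)"
  have C: "p \<in> ?C \<longleftrightarrow> (\<forall>t\<in>Poly_Mapping.keys p. Poly_Mapping.keys t \<subseteq> entries m n)" for p :: "'a mpoly"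
    by (simp add: poly_ring_def)
  have plus: "p + q \<in> ?C" if "p \<in> ?C" "q \<in> ?C" for p q
    using that Poly_Mapping.keys_add[of p q] unfolding C by blast
  have uminus: "- p \<in> ?C" if "p \<in> ?C" for p
    using that unfolding C by simp
  have times: "p * q \<in> ?C" if p: "p \<in> ?C" and q: "q \<in> ?C" for p q
    unfolding C
  proof
    fix t assume "t \<in> Poly_Mapping.keys (p * q)"
    then obtain a b where "a \<in> Poly_Mapping.keys p" "b \<in> Poly_Mapping.keys q" "t = a + b"
      using keys_mult[of p q] by blast
    with p q Poly_Mapping.keys_add[of a b] show "Poly_Mapping.keys t \<subseteq> entries m n"
      unfolding C by blast
  qed
  have zero: "0 \<in> ?C" and one: "1 \<in> ?C"
    unfolding C by (auto simp flip: single_one)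
  have ops: "monoid.mult (poly_ring m n) = ((*) :: 'a mpoly \<Rightarrow> _)"
    "monoid.one (poly_ring m n) = (1 :: 'a mpoly)"
    "ring.zero (poly_ring m n) = (0 :: 'a mpoly)"
    "ring.add (poly_ring m n) = ((+) :: 'a mpoly \<Rightarrow> _)"
    by (simp_all add: poly_ring_def)
  show ?thesis
  proof (rule cringI)
    show "abelian_group (poly_ring m n :: 'a mpoly ring)"
    proof (rule abelian_groupI, unfold ops)
      fix p assume "p \<in> ?C"
      then show "\<exists>q\<in>?C. q + p = 0"
        by (intro bexI[of _ "- p"] uminus) simp
    qed (simp_all add: plus zero ac_simps)
    show "comm_monoid (poly_ring m n :: 'a mpoly ring)"
      by (rule comm_monoidI, unfold ops) (simp_all add: times one ac_simps)
  qed (unfold ops, rule distrib_right)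
qed

definition generic_matrix :: "nat \<Rightarrow> nat \<Rightarrow> 'a::field mpoly mat" where
  "generic_matrix m n = mat m n (\<lambda>v. Poly_Mapping.single (Poly_Mapping.single v 1) 1)"

text \<open>A block is given by the positions of its entries; \<open>I \<times> J \<subseteq> B\<close> says that all entries of the
  submatrix belong to the block.\<close>

definition minors_in :: "nat \<Rightarrow> nat \<Rightarrow> nat \<Rightarrow> pos set \<Rightarrow> 'a::field mpoly set" where
  "minors_in m n r B =
     {det (submatrix (generic_matrix m n) I J) | I J.
        I \<subseteq> {..<m} \<and> J \<subseteq> {..<n} \<and> card I = r \<and> card J = r \<and> I \<times> J \<subseteq> B}"

definition blockwise_determinantal_ideal ::
    "nat \<Rightarrow> nat \<Rightarrow> nat \<Rightarrow> (nat \<Rightarrow> pos set) \<Rightarrow> (nat \<Rightarrow> nat) \<Rightarrow> 'a::field mpoly set" where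
  "blockwise_determinantal_ideal m n k B r =
     Idl\<^bsub>poly_ring m n\<^esub> (\<Union>i<k. minors_in m n (r i) (B i))"

datatype scan_order = NW_by_rows | NW_by_columns | SE_by_rows | SE_by_columns

text \<open>\<open>var_greater \<sigma> v w\<close>: \<open>v\<close> is scanned before \<open>w\<close>, i.e. it is
  the greater variable. Scanning from the southeast corner visits the positions in exactly the
  reverse of the corresponding order from the northwest corner.\<close>

fun var_greater :: "scan_order \<Rightarrow> pos \<Rightarrow> pos \<Rightarrow> bool" where
  "var_greater NW_by_rows (i, j) (i', j') \<longleftrightarrow> i < i' \<or> i = i' \<and> j < j'"
| "var_greater NW_by_columns (i, j) (i', j') \<longleftrightarrow> j < j' \<or> j = j' \<and> i < i'"
| "var_greater SE_by_rows (i, j) (i', j') \<longleftrightarrow> i > i' \<or> i = i' \<and> j > j'"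
| "var_greater SE_by_columns (i, j) (i', j') \<longleftrightarrow> j > j' \<or> j = j' \<and> i > i'"

definition lex_less :: "scan_order \<Rightarrow> monomial \<Rightarrow> monomial \<Rightarrow> bool" where
  "lex_less \<sigma> s t \<longleftrightarrow>
     (\<exists>v. Poly_Mapping.lookup s v < Poly_Mapping.lookup t v \<and>
        (\<forall>w. var_greater \<sigma> w v \<longrightarrow> Poly_Mapping.lookup s w = Poly_Mapping.lookup t w))"

lemma var_greater_irrefl: "\<not> var_greater \<sigma> v v"
  by (cases v; cases \<sigma>) auto

lemma var_greater_trans: "var_greater \<sigma> u v \<Longrightarrow> var_greater \<sigma> v w \<Longrightarrow> var_greater \<sigma> u w"
  by (cases u; cases v; cases w; cases \<sigma>) auto

lemma var_greater_total: "v \<noteq> w \<Longrightarrow> var_greater \<sigma> v w \<or> var_greater \<sigma> w v"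
  by (cases v; cases w; cases \<sigma>) auto

lemma lex_less_irrefl: "\<not> lex_less \<sigma> s s"
  unfolding lex_less_def by blast

lemma lex_less_trans:
  assumes "lex_less \<sigma> s t" "lex_less \<sigma> t u"
  shows "lex_less \<sigma> s u"
proof -
  obtain v where v: "Poly_Mapping.lookup s v < Poly_Mapping.lookup t v"
    and eq: "\<And>w. var_greater \<sigma> w v \<Longrightarrow> Poly_Mapping.lookup s w = Poly_Mapping.lookup t w"
    using assms(1) unfolding lex_less_def by blast
  obtain v' where v': "Poly_Mapping.lookup t v' < Poly_Mapping.lookup u v'"
    and eq': "\<And>w. var_greater \<sigma> w v' \<Longrightarrow> Poly_Mapping.lookup t w = Poly_Mapping.lookup u w"
    using assms(2) unfolding lex_less_def by blast
  consider "v = v'" | "var_greater \<sigma> v v'" | "var_greater \<sigma> v' v"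
    using var_greater_total by blast
  then show ?thesis
  proof cases
    case 1
    with v v' eq eq' show ?thesis
      unfolding lex_less_def by (intro exI[of _ v]) simp
  next
    case 2
    then show ?thesis
      unfolding lex_less_def using v eq eq' var_greater_trans[OF _ 2]
      by (intro exI[of _ v]) simp
  next
    case 3
    then show ?thesis
      unfolding lex_less_def using v' eq eq' var_greater_trans[OF _ 3]
      by (intro exI[of _ v']) simp
  qed
qed

lemma lex_less_total:
  assumes "s \<noteq> t"
  shows "lex_less \<sigma> s t \<or> lex_less \<sigma> t s"
proof -
  define D where "D = {v. Poly_Mapping.lookup s v \<noteq> Poly_Mapping.lookup t v}"
  have "D \<subseteq> Poly_Mapping.keys s \<union> Poly_Mapping.keys t"
    by (auto simp: D_def in_keys_iff)
  then have "finite D"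
    by (rule finite_subset) simp
  moreover have "D \<noteq> {}"
    using assms by (auto simp: D_def intro: poly_mapping_eqI)
  moreover have "asymp_on D (var_greater \<sigma>)" "transp_on D (var_greater \<sigma>)"
    by (metis asymp_onI var_greater_irrefl var_greater_trans)
      (metis transp_onI var_greater_trans)
  ultimately obtain v where v: "v \<in> D" "\<forall>w\<in>D. w \<noteq> v \<longrightarrow> \<not> var_greater \<sigma> w v"
    using Finite_Set.bex_min_element[of D "var_greater \<sigma>"] by blast
  have "Poly_Mapping.lookup s w = Poly_Mapping.lookup t w" if "var_greater \<sigma> w v" for w
  proof (rule ccontr)
    assume "\<not> ?thesis"
    then have "w \<in> D" by (simp add: D_def)
    moreover have "w \<noteq> v" using that var_greater_irrefl[of \<sigma> v] by metis
    ultimately show False using v(2) that by blast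
  qed
  moreover have "Poly_Mapping.lookup s v < Poly_Mapping.lookup t v \<or>
      Poly_Mapping.lookup t v < Poly_Mapping.lookup s v"
    using v(1) by (auto simp: D_def)
  ultimately show ?thesis
    unfolding lex_less_def by (metis (lifting))
qed

definition lead_monomial :: "scan_order \<Rightarrow> 'a::field mpoly \<Rightarrow> monomial" where
  "lead_monomial \<sigma> p =
     (THE t. t \<in> Poly_Mapping.keys p \<and>
        (\<forall>s\<in>Poly_Mapping.keys p. s \<noteq> t \<longrightarrow> lex_less \<sigma> s t))"

lemma ex1_lead_monomial:
  assumes "p \<noteq> 0"
  shows "\<exists>!t. t \<in> Poly_Mapping.keys p \<and> (\<forall>s\<in>Poly_Mapping.keys p. s \<noteq> t \<longrightarrow> lex_less \<sigma> s t)"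
proof -
  have "asymp_on (Poly_Mapping.keys p) (lex_less \<sigma>)" "transp_on (Poly_Mapping.keys p) (lex_less \<sigma>)"
    by (metis asymp_onI lex_less_irrefl lex_less_trans) (metis transp_onI lex_less_trans)
  moreover have "Poly_Mapping.keys p \<noteq> {}"
    using assms by simp
  ultimately obtain t where t: "t \<in> Poly_Mapping.keys p"
    "\<forall>s\<in>Poly_Mapping.keys p. s \<noteq> t \<longrightarrow> \<not> lex_less \<sigma> t s"
    using Finite_Set.bex_max_element[of "Poly_Mapping.keys p" "lex_less \<sigma>"] finite_keys by blast
  show ?thesis
  proof (rule ex1I[of _ t])
    show "t \<in> Poly_Mapping.keys p \<and> (\<forall>s\<in>Poly_Mapping.keys p. s \<noteq> t \<longrightarrow> lex_less \<sigma> s t)"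
      using t lex_less_total by blast
  next
    fix t' assume "t' \<in> Poly_Mapping.keys p \<and> (\<forall>s\<in>Poly_Mapping.keys p. s \<noteq> t' \<longrightarrow> lex_less \<sigma> s t')"
    with t show "t' = t" by metis
  qed
qed

definition lead_term :: "scan_order \<Rightarrow> 'a::field mpoly \<Rightarrow> 'a mpoly" where
  "lead_term \<sigma> p =
     Poly_Mapping.single (lead_monomial \<sigma> p) (Poly_Mapping.lookup p (lead_monomial \<sigma> p))"

definition initial_ideal :: "nat \<Rightarrow> nat \<Rightarrow> scan_order \<Rightarrow> 'a::field mpoly set \<Rightarrow> 'a mpoly set" where
  "initial_ideal m n \<sigma> S = Idl\<^bsub>poly_ring m n\<^esub> (lead_term \<sigma> ` (S - {0}))"

text \<open>The empty set is a Groebner basis of the zero ideal; this covers blocks that contain no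
  minor of the prescribed size.\<close>

definition groebner_basis ::
    "nat \<Rightarrow> nat \<Rightarrow> scan_order \<Rightarrow> 'a::field mpoly set \<Rightarrow> 'a mpoly set \<Rightarrow> bool" where
  "groebner_basis m n \<sigma> G I \<longleftrightarrow>
     finite G \<and> G \<subseteq> I \<and> initial_ideal m n \<sigma> G = initial_ideal m n \<sigma> I"

text \<open>\<open>u\<close> is the upper corner and \<open>L\<close> lists the lower corners. Their columns only
  decrease weakly, so the list may contain corners that do not change the ladder.\<close>

definition lower_corners :: "nat \<Rightarrow> nat \<Rightarrow> pos \<Rightarrow> pos list \<Rightarrow> bool" where
  "lower_corners m n u L \<longleftrightarrow>
     L \<noteq> [] \<and> sorted_wrt (\<lambda>(a, b) (a', b'). a < a' \<and> b \<ge> b') L \<and>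
     (\<forall>(a, b)\<in>set L. fst u \<le> a \<and> a < m \<and> snd u \<le> b \<and> b < n)"

definition one_sided_ladder :: "pos \<Rightarrow> pos list \<Rightarrow> pos set" where
  "one_sided_ladder u L =
     {(p, q). \<exists>(a, b)\<in>set L. fst u \<le> p \<and> p \<le> a \<and> snd u \<le> q \<and> q \<le> b}"

end

theory Submission
  imports Defs
begin

text \<open>The proof has an algebraic and a combinatorial half.

  Algebra: for a sum of ideals, the union of Groebner bases can fail to be a Groebner basis only
  through cancellation of leading terms between different ideals. If every common multiple of leading
  monomials of two of the ideals is a multiple of the leading monomial of an element of their
  intersection, then a multiple of this element can be subtracted from one summand and added to the
  other, and all cancellations can be removed (\<open>lead_monomial_sum_ideals\<close>,
  \<open>groebner_basis_UN\<close>).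

  Combinatorics: the leading monomial of a minor is the product of its diagonal, a chain of positions
  from northwest to southeast. A minor in a ladder lies in the rectangle between the upper corner and
  one of the lower corners. The hypothesis on the lower corners says that, for two minors from
  different blocks, one of these rectangles is at least as wide and the other one at least as tall.
  Let \<open>\<alpha>\<close> and \<open>\<beta>\<close> be the diagonals of a minor in the wide rectangle and of one in the tall
  rectangle. By exchanging initial segments one can assume that \<open>\<alpha>\<close> and \<open>\<beta>\<close> first coincide and
  that \<open>\<alpha>\<close> then stays northeast of \<open>\<beta>\<close> as long as both last (\<open>uncross_chains\<close>).

  Write \<open>\<alpha>\<^sub>2\<close> and \<open>\<beta>\<^sub>2\<close> for the parts after the common one, and \<open>X(P, Q)\<close> for the matrix of
  variables in the rows of \<open>P\<close> and the columns of \<open>Q\<close>. The element of the intersection is the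
  determinant of the glued block matrix with first block row \<open>X(\<alpha>, \<beta>)\<close>, \<open>X(\<alpha>, \<alpha>\<^sub>2)\<close> and second
  block row \<open>X(\<beta>\<^sub>2, \<beta>)\<close>, \<open>0\<close>. Laplace expansion along the first block row shows that it lies in
  the ideal of minors of the wide rectangle, expansion along the first block column that it lies in
  the ideal of minors of the tall one. Its leading monomial is the product of the positions in \<open>\<alpha>\<close> or
  \<open>\<beta>\<close>, each taken once (\<open>lead_monomial_det_glued\<close>), and therefore divides every common multiple of
  the two diagonals. If the common part is empty, this determinant is, up to sign, the product of the
  minors with the diagonals \<open>\<alpha>\<close> and \<open>\<beta>\<close>.
\<close>

section \<open>Ideals of the polynomial ring\<close>

lemma poly_ring_ops [simp]:
  "monoid.mult (poly_ring m n) = ((*) :: 'a::field mpoly \<Rightarrow> _)"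
  "monoid.one (poly_ring m n) = (1 :: 'a mpoly)"
  "ring.zero (poly_ring m n) = (0 :: 'a mpoly)"
  "ring.add (poly_ring m n) = ((+) :: 'a mpoly \<Rightarrow> _)"
  by (simp_all add: poly_ring_def)

lemma in_carrier_iff:
  "p \<in> carrier (poly_ring m n) \<longleftrightarrow> (\<forall>t\<in>Poly_Mapping.keys p. Poly_Mapping.keys t \<subseteq> entries m n)"
  by (simp add: poly_ring_def)

lemma monomial_in_carrier:
  "Poly_Mapping.keys t \<subseteq> entries m n \<Longrightarrow> Poly_Mapping.single t c \<in> carrier (poly_ring m n)"
  by (auto simp: in_carrier_iff)

lemma constant_in_carrier: "Poly_Mapping.single 0 c \<in> carrier (poly_ring m n)"
  by (simp add: monomial_in_carrier)

lemma ring_poly_ring: "ring (poly_ring m n)"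
  using cring_poly_ring by (rule cring.axioms)

lemma times_in_carrier:
  "p \<in> carrier (poly_ring m n) \<Longrightarrow> q \<in> carrier (poly_ring m n) \<Longrightarrow> p * q \<in> carrier (poly_ring m n)"
  using ring.ring_simprules(5)[OF ring_poly_ring, of p m n q] by simp

lemma of_int_in_carrier: "of_int z \<in> carrier (poly_ring m n)"
  by (simp add: constant_in_carrier flip: single_of_int)

lemma ideal_poly_ringI:
  fixes J :: "'a::field mpoly set"
  assumes carrier: "J \<subseteq> carrier (poly_ring m n)" and zero: "0 \<in> J"
    and add: "\<And>p q. p \<in> J \<Longrightarrow> q \<in> J \<Longrightarrow> p + q \<in> J"
    and mult: "\<And>p q. p \<in> carrier (poly_ring m n) \<Longrightarrow> q \<in> J \<Longrightarrow> p * q \<in> J"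
  shows "ideal J (poly_ring m n)"
proof (rule idealI[OF ring_poly_ring])
  interpret cring "poly_ring m n :: 'a mpoly ring" by (rule cring_poly_ring)
  show "subgroup J (add_monoid (poly_ring m n))"
  proof (rule add.subgroupI)
    fix p assume p: "p \<in> J"
    then have "p \<in> carrier (poly_ring m n)"
      using carrier by blast
    then have "\<ominus>\<^bsub>poly_ring m n\<^esub> p =
        \<ominus>\<^bsub>poly_ring m n\<^esub> \<one>\<^bsub>poly_ring m n\<^esub> \<otimes>\<^bsub>poly_ring m n\<^esub> p"
      by (simp only: l_minus[OF one_closed] l_one)
    then show "\<ominus>\<^bsub>poly_ring m n\<^esub> p \<in> J"
      using mult[OF a_inv_closed[OF one_closed] p] by (simp only: poly_ring_ops)
  qed (use carrier zero add in auto)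
next
  fix a x :: "'a mpoly" assume "a \<in> J" "x \<in> carrier (poly_ring m n)"
  then have "x * a \<in> J" by (intro mult)
  then show "x \<otimes>\<^bsub>poly_ring m n\<^esub> a \<in> J" "a \<otimes>\<^bsub>poly_ring m n\<^esub> x \<in> J"
    by (simp_all add: mult.commute)
qed

context
  fixes J :: "'a::field mpoly set" and m n :: nat
  assumes J: "ideal J (poly_ring m n)"
begin

interpretation ideal J "poly_ring m n :: 'a mpoly ring" by (rule J)

lemma ideal_zero: "0 \<in> J"
  using additive_subgroup.zero_closed[OF ideal.axioms(1)[OF J]] by simp

lemma ideal_add: "p \<in> J \<Longrightarrow> q \<in> J \<Longrightarrow> p + q \<in> J"
  using additive_subgroup.a_closed[OF ideal.axioms(1)[OF J]] by simp

lemma ideal_mult: "p \<in> carrier (poly_ring m n) \<Longrightarrow> q \<in> J \<Longrightarrow> p * q \<in> J"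
  using I_l_closed by simp

lemma ideal_carrier: "p \<in> J \<Longrightarrow> p \<in> carrier (poly_ring m n)"
  by simp

lemma ideal_sum: "(\<And>i. i \<in> A \<Longrightarrow> f i \<in> J) \<Longrightarrow> sum f A \<in> J"
  by (induction A rule: infinite_finite_induct) (auto intro: ideal_zero ideal_add)

end

lemma ideal_Idl:
  "S \<subseteq> carrier (poly_ring m n) \<Longrightarrow> ideal (Idl\<^bsub>poly_ring m n\<^esub> S) (poly_ring m n)"
  by (rule ring.genideal_ideal[OF ring_poly_ring])

lemma Idl_superset: "S \<subseteq> carrier (poly_ring m n) \<Longrightarrow> S \<subseteq> Idl\<^bsub>poly_ring m n\<^esub> S"
  by (rule ring.genideal_self[OF ring_poly_ring])

lemma Idl_least:
  "ideal J (poly_ring m n) \<Longrightarrow> S \<subseteq> J \<Longrightarrow> Idl\<^bsub>poly_ring m n\<^esub> S \<subseteq> J"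
  by (rule ring.genideal_minimal[OF ring_poly_ring])

text \<open>The elements of a sum of ideals are the sums of their elements, because these sums form an
  ideal.\<close>

lemma Idl_UN_cases:
  fixes G :: "nat \<Rightarrow> 'a::field mpoly set"
  assumes G: "\<And>i. i < k \<Longrightarrow> G i \<subseteq> carrier (poly_ring m n)"
    and f: "f \<in> Idl\<^bsub>poly_ring m n\<^esub> (\<Union>i<k. G i)"
  obtains F where "\<And>i. i < k \<Longrightarrow> F i \<in> Idl\<^bsub>poly_ring m n\<^esub> (G i)" "f = (\<Sum>i<k. F i)"
proof -
  let ?I = "\<lambda>i. Idl\<^bsub>poly_ring m n\<^esub> (G i)"
  define J where "J = {\<Sum>i<k. F i | F. \<forall>i<k. F i \<in> ?I i}"
  have I: "ideal (?I i) (poly_ring m n)" if "i < k" for i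
    using ideal_Idl G that by blast
  have "ideal J (poly_ring m n)"
  proof (rule ideal_poly_ringI)
    have "(\<Sum>i<k. F i) \<in> carrier (poly_ring m n)" if "\<forall>i<k. F i \<in> ?I i" for F
      using that ideal_carrier[OF I] by (intro ideal_sum[OF ring.oneideal[OF ring_poly_ring]]) auto
    then show "J \<subseteq> carrier (poly_ring m n)"
      unfolding J_def by blast
    show "0 \<in> J"
      unfolding J_def using ideal_zero[OF I] by (auto intro!: exI[of _ "\<lambda>_. 0"])
  next
    fix p q assume "p \<in> J" "q \<in> J"
    then obtain P Q where "\<forall>i<k. P i \<in> ?I i" "p = (\<Sum>i<k. P i)"
      and "\<forall>i<k. Q i \<in> ?I i" "q = (\<Sum>i<k. Q i)"
      unfolding J_def by blast
    then show "p + q \<in> J"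
      unfolding J_def using ideal_add[OF I]
      by (auto intro!: exI[of _ "\<lambda>i. P i + Q i"] simp: sum.distrib)
  next
    fix p q :: "'a mpoly" assume "p \<in> carrier (poly_ring m n)" "q \<in> J"
    moreover from this obtain Q where "\<forall>i<k. Q i \<in> ?I i" "q = (\<Sum>i<k. Q i)"
      unfolding J_def by blast
    ultimately show "p * q \<in> J"
      unfolding J_def using ideal_mult[OF I]
      by (auto intro!: exI[of _ "\<lambda>i. p * Q i"] simp: sum_distrib_left)
  qed
  moreover have "(\<Union>i<k. G i) \<subseteq> J"
  proof
    fix g assume "g \<in> (\<Union>i<k. G i)"
    then obtain i where i: "i < k" "g \<in> G i" by blast
    have "g = (\<Sum>j<k. if j = i then g else 0)"
      using i by (simp add: sum.delta)
    moreover have "g \<in> ?I i"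
      using i Idl_superset[OF G] by blast
    then have "\<forall>j<k. (if j = i then g else 0) \<in> ?I j"
      using ideal_zero[OF I] by simp
    ultimately show "g \<in> J"
      unfolding J_def by (intro CollectI exI[of _ "\<lambda>j. if j = i then g else 0"]) simp
  qed
  ultimately have "f \<in> J"
    using f Idl_least by blast
  then show thesis
    using that unfolding J_def by blast
qed

section \<open>Leading monomials\<close>

lemma lex_less_add: "lex_less \<sigma> s t \<Longrightarrow> lex_less \<sigma> (u + s) (u + t)"
  by (auto simp: lex_less_def lookup_add)

text \<open>The lexicographic order is a well-order as long as only finitely many variables matter:
  minimise the exponent of the greatest of these variables first, then the remaining exponents.\<close>

lemma lex_less_minimal:
  assumes "finite V" and "S \<noteq> {}"
    and "\<And>s t w. s \<in> S \<Longrightarrow> t \<in> S \<Longrightarrow> w \<notin> V \<Longrightarrow> Poly_Mapping.lookup s w = Poly_Mapping.lookup t w"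
  shows "\<exists>s\<in>S. \<forall>t\<in>S. \<not> lex_less \<sigma> t s"
  using assms
proof (induction V arbitrary: S rule: finite_psubset_induct)
  case (psubset V)
  show ?case
  proof (cases "V = {}")
    case True
    then have "s = t" if "s \<in> S" "t \<in> S" for s t
      using True that by (intro poly_mapping_eqI psubset.prems(2)) simp_all
    with psubset.prems(1) lex_less_irrefl show ?thesis by blast
  next
    case False
    moreover have "asymp_on V (var_greater \<sigma>)" "transp_on V (var_greater \<sigma>)"
      by (metis asymp_onI var_greater_irrefl var_greater_trans)
        (metis transp_onI var_greater_trans)
    ultimately obtain v where v: "v \<in> V" "\<forall>w\<in>V. w \<noteq> v \<longrightarrow> \<not> var_greater \<sigma> w v"
      using Finite_Set.bex_min_element[of V "var_greater \<sigma>"] psubset.hyps by blast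
    obtain s0 where s0: "s0 \<in> S"
      and least: "\<And>t. t \<in> S \<Longrightarrow> Poly_Mapping.lookup s0 v \<le> Poly_Mapping.lookup t v"
      using ex_has_least_nat[of "\<lambda>s. s \<in> S" _ "\<lambda>s. Poly_Mapping.lookup s v"] psubset.prems(1)
      by (metis all_not_in_conv)
    define S' where "S' = {s \<in> S. Poly_Mapping.lookup s v = Poly_Mapping.lookup s0 v}"
    have "\<exists>s\<in>S'. \<forall>t\<in>S'. \<not> lex_less \<sigma> t s"
    proof (rule psubset.IH)
      show "V - {v} \<subset> V" using v by blast
      show "S' \<noteq> {}" using s0 by (auto simp: S'_def)
      show "Poly_Mapping.lookup s w = Poly_Mapping.lookup t w"
        if "s \<in> S'" "t \<in> S'" "w \<notin> V - {v}" for s t w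
        using that psubset.prems(2)[of s t w] by (cases "w = v") (auto simp: S'_def)
    qed
    then obtain s where s: "s \<in> S'" "\<And>t. t \<in> S' \<Longrightarrow> \<not> lex_less \<sigma> t s" by blast
    have "\<not> lex_less \<sigma> t s" if t: "t \<in> S" for t
    proof
      assume less: "lex_less \<sigma> t s"
      then obtain w where w: "Poly_Mapping.lookup t w < Poly_Mapping.lookup s w"
        and eq: "\<And>w'. var_greater \<sigma> w' w \<Longrightarrow> Poly_Mapping.lookup t w' = Poly_Mapping.lookup s w'"
        unfolding lex_less_def by blast
      have "w \<in> V" "w \<noteq> v"
        using w s(1) t psubset.prems(2)[of t s w] least[OF t] by (auto simp: S'_def)
      then have "var_greater \<sigma> v w"
        using v var_greater_total by blast
      then have "t \<in> S'"
        using eq s(1) t by (auto simp: S'_def)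
      with s(2) less show False by blast
    qed
    with s(1) show ?thesis unfolding S'_def by blast
  qed
qed

lemma wfp_lex_less:
  "wfp (\<lambda>s t. Poly_Mapping.keys s \<subseteq> entries m n \<and> Poly_Mapping.keys t \<subseteq> entries m n \<and> lex_less \<sigma> s t)"
  (is "wfp ?R")
unfolding wfp_iff_ex_minimal
proof (intro allI impI)
  fix S :: "monomial set"
  assume "S \<noteq> {}"
  let ?S = "{t \<in> S. Poly_Mapping.keys t \<subseteq> entries m n}"
  show "\<exists>s\<in>S. \<forall>t. ?R t s \<longrightarrow> t \<notin> S"
  proof (cases "?S = {}")
    case True
    with \<open>S \<noteq> {}\<close> show ?thesis by blast
  next
    case False
    have "\<exists>s\<in>?S. \<forall>t\<in>?S. \<not> lex_less \<sigma> t s"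
    proof (rule lex_less_minimal[where V = "entries m n"])
      show "finite (entries m n)" by (simp add: entries_def)
      show "Poly_Mapping.lookup s w = Poly_Mapping.lookup t w"
        if "s \<in> ?S" "t \<in> ?S" "w \<notin> entries m n" for s t w
        using that by (metis (mono_tags, lifting) in_keys_iff mem_Collect_eq subsetD)
    qed (fact False)
    then show ?thesis by blast
  qed
qed

lemma lead_monomial_in_keys: "p \<noteq> 0 \<Longrightarrow> lead_monomial \<sigma> p \<in> Poly_Mapping.keys p"
  and lead_monomial_greatest:
    "p \<noteq> 0 \<Longrightarrow> s \<in> Poly_Mapping.keys p \<Longrightarrow> s \<noteq> lead_monomial \<sigma> p \<Longrightarrow> lex_less \<sigma> s (lead_monomial \<sigma> p)"
  using theI'[OF ex1_lead_monomial[of p \<sigma>]] unfolding lead_monomial_def by blast+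

lemma lead_monomial_eqI:
  assumes t: "t \<in> Poly_Mapping.keys p" "\<And>s. s \<in> Poly_Mapping.keys p \<Longrightarrow> s = t \<or> lex_less \<sigma> s t"
  shows "lead_monomial \<sigma> p = t"
proof -
  have "p \<noteq> 0" using t(1) by auto
  from lead_monomial_in_keys[OF this, of \<sigma>] lead_monomial_greatest[OF this t(1), of \<sigma>] t(2) show ?thesis
    by (metis lex_less_irrefl lex_less_trans)
qed

lemma lead_monomial_keys:
  assumes "p \<in> carrier (poly_ring m n)" "p \<noteq> 0"
  shows "Poly_Mapping.keys (lead_monomial \<sigma> p) \<subseteq> entries m n"
  using assms lead_monomial_in_keys unfolding in_carrier_iff by blast

lemma lead_term_in_carrier:
  "p \<in> carrier (poly_ring m n) \<Longrightarrow> p \<noteq> 0 \<Longrightarrow> lead_term \<sigma> p \<in> carrier (poly_ring m n)"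
  unfolding lead_term_def by (intro monomial_in_carrier lead_monomial_keys)

lemma lookup_single_times:
  fixes p :: "'a::field mpoly"
  shows "Poly_Mapping.lookup (Poly_Mapping.single u c * p) (u + t) = c * Poly_Mapping.lookup p t"
proof -
  have "Poly_Mapping.lookup (Poly_Mapping.single u c * p) (u + t) =
      (\<Sum>l. c * (\<Sum>q. Poly_Mapping.lookup p q when u + t = l + q) when l = u)"
    unfolding lookup_mult lookup_single by (intro Sum_any.cong) (auto simp: when_def)
  also have "\<dots> = c * (\<Sum>q. Poly_Mapping.lookup p q when t = q)"
    by simp
  finally show ?thesis by simp
qed

lemma lead_monomial_single_times:
  fixes p :: "'a::field mpoly"
  assumes "p \<noteq> 0" "c \<noteq> 0"
  shows "lead_monomial \<sigma> (Poly_Mapping.single u c * p) = u + lead_monomial \<sigma> p"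
proof (rule lead_monomial_eqI)
  show "u + lead_monomial \<sigma> p \<in> Poly_Mapping.keys (Poly_Mapping.single u c * p)"
    using assms lead_monomial_in_keys[OF assms(1), of \<sigma>] by (simp add: in_keys_iff lookup_single_times)
next
  fix s assume "s \<in> Poly_Mapping.keys (Poly_Mapping.single u c * p)"
  then obtain t where "s = u + t" "t \<in> Poly_Mapping.keys p"
    using keys_mult[of "Poly_Mapping.single u c" p] by (auto split: if_splits)
  then show "s = u + lead_monomial \<sigma> p \<or> lex_less \<sigma> s (u + lead_monomial \<sigma> p)"
    using lead_monomial_greatest[OF assms(1), of t \<sigma>] lex_less_add[of \<sigma> t _ u]
    by (cases "t = lead_monomial \<sigma> p") auto
qed

text \<open>An initial ideal is a monomial ideal: the polynomials all of whose monomials are multiples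
  of leading monomials of \<open>S\<close> form an ideal.\<close>

lemma initial_ideal_divisible:
  fixes S :: "'a::field mpoly set"
  assumes p: "p \<in> initial_ideal m n \<sigma> S" and S: "S \<subseteq> carrier (poly_ring m n)"
    and t: "t \<in> Poly_Mapping.keys p"
  obtains g u where "g \<in> S" "g \<noteq> 0" "t = lead_monomial \<sigma> g + u"
proof -
  define M where "M = {lead_monomial \<sigma> g + u | g u. g \<in> S \<and> g \<noteq> 0}"
  define J :: "'a mpoly set" where "J = {p \<in> carrier (poly_ring m n). Poly_Mapping.keys p \<subseteq> M}"
  have "ideal J (poly_ring m n)"
  proof (rule ideal_poly_ringI)
    show "J \<subseteq> carrier (poly_ring m n)" unfolding J_def by blast
    show "0 \<in> J" unfolding J_def by (simp add: in_carrier_iff)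
  next
    fix p q assume "p \<in> J" "q \<in> J"
    then show "p + q \<in> J"
      using Poly_Mapping.keys_add[of p q] unfolding J_def in_carrier_iff by blast
  next
    fix p q :: "'a mpoly" assume p: "p \<in> carrier (poly_ring m n)" and q: "q \<in> J"
    have "Poly_Mapping.keys (p * q) \<subseteq> M"
    proof
      fix s assume "s \<in> Poly_Mapping.keys (p * q)"
      then obtain a b where "s = a + b" "b \<in> Poly_Mapping.keys q"
        using keys_mult[of p q] by blast
      moreover from this q obtain g u where "b = lead_monomial \<sigma> g + u" "g \<in> S" "g \<noteq> 0"
        unfolding J_def M_def by blast
      ultimately have "s = lead_monomial \<sigma> g + (u + a)" "g \<in> S" "g \<noteq> 0"
        by (simp_all add: ac_simps)
      then show "s \<in> M" unfolding M_def by blast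
    qed
    with p q show "p * q \<in> J"
      unfolding J_def by (simp add: times_in_carrier)
  qed
  moreover have "lead_term \<sigma> ` (S - {0}) \<subseteq> J"
  proof
    fix q assume "q \<in> lead_term \<sigma> ` (S - {0})"
    then obtain g where g: "g \<in> S" "g \<noteq> 0" "q = lead_term \<sigma> g" by blast
    then have "lead_monomial \<sigma> g + 0 \<in> M" unfolding M_def by blast
    with g S show "q \<in> J"
      unfolding J_def using lead_term_in_carrier[of g m n \<sigma>] by (auto simp: lead_term_def)
  qed
  ultimately have "p \<in> J"
    using p Idl_least unfolding initial_ideal_def by blast
  with t that show thesis unfolding J_def M_def by blast
qed

lemma ideal_initial_ideal:
  "S \<subseteq> carrier (poly_ring m n) \<Longrightarrow> ideal (initial_ideal m n \<sigma> S) (poly_ring m n)"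
  unfolding initial_ideal_def using lead_term_in_carrier by (intro ideal_Idl) blast

lemma lead_term_in_initial_ideal:
  assumes "S \<subseteq> carrier (poly_ring m n)" "p \<in> S" "p \<noteq> 0"
  shows "lead_term \<sigma> p \<in> initial_ideal m n \<sigma> S"
proof -
  have "lead_term \<sigma> ` (S - {0}) \<subseteq> carrier (poly_ring m n)"
    using assms(1) lead_term_in_carrier by blast
  from Idl_superset[OF this] assms(2,3) show ?thesis
    unfolding initial_ideal_def by blast
qed

lemma initial_ideal_mono:
  assumes "S \<subseteq> T" "T \<subseteq> carrier (poly_ring m n)"
  shows "initial_ideal m n \<sigma> S \<subseteq> initial_ideal m n \<sigma> T"
  using Idl_least[OF ideal_initial_ideal[OF assms(2)], of "lead_term \<sigma> ` (S - {0})"]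
    lead_term_in_initial_ideal[OF assms(2)] assms(1)
  by (auto simp: initial_ideal_def[of _ _ _ S])

section \<open>Groebner bases of sums of ideals\<close>

text \<open>A representation of an element of the sum in which some leading monomial exceeds that of the
  element has at least two summands with the greatest leading monomial, \<open>t\<close>. Subtracting a
  multiple of \<open>h\<close> from one and adding it to the other, where \<open>h\<close> lies in both
  ideals and also has the leading monomial \<open>t\<close>, lowers the number of
  summands that contain \<open>t\<close>. Since the order on monomials is well-founded, this ends.\<close>

lemma lead_monomial_sum_ideals:
  fixes I :: "nat \<Rightarrow> 'a::field mpoly set"
  assumes ideal: "\<And>i. i < k \<Longrightarrow> ideal (I i) (poly_ring m n)"
    and common: "\<And>i j p q. i < k \<Longrightarrow> j < k \<Longrightarrow> i \<noteq> j \<Longrightarrow> p \<in> I i \<Longrightarrow> q \<in> I j \<Longrightarrow> p \<noteq> 0 \<Longrightarrow> q \<noteq> 0 \<Longrightarrow>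
      lead_monomial \<sigma> p = lead_monomial \<sigma> q \<Longrightarrow>
      \<exists>h\<in>I i \<inter> I j. h \<noteq> 0 \<and> lead_monomial \<sigma> h = lead_monomial \<sigma> p"
    and F: "\<And>i. i < k \<Longrightarrow> F i \<in> I i" and f: "f = (\<Sum>i<k. F i)" "f \<noteq> 0"
  shows "\<exists>i<k. \<exists>p\<in>I i. p \<noteq> 0 \<and> lead_monomial \<sigma> p = lead_monomial \<sigma> f"
proof -
  let ?E = "\<lambda>t. Poly_Mapping.keys t \<subseteq> entries m n"
  let ?supp = "\<lambda>F. \<Union>i<k. Poly_Mapping.keys (F i)"
  have supp_entries: "?E t" if "t \<in> ?supp F" "\<And>i. i < k \<Longrightarrow> F i \<in> I i" for t F
    using that ideal_carrier[OF ideal] by (auto simp: in_carrier_iff) blast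
  have keys_f: "Poly_Mapping.keys f \<subseteq> ?supp F" if "f = (\<Sum>i<k. F i)" for F
    using keys_sum[of F "{..<k}"] that by blast
  have main: "\<exists>i<k. \<exists>p\<in>I i. p \<noteq> 0 \<and> lead_monomial \<sigma> p = lead_monomial \<sigma> f"
    if "?E t" "\<And>i. i < k \<Longrightarrow> F i \<in> I i" "f = (\<Sum>i<k. F i)"
      "\<And>s. s \<in> ?supp F \<Longrightarrow> s = t \<or> lex_less \<sigma> s t" for t F
    using that
    (* outer induction on a bound t for the monomials of the summands, inner induction on the number
       of summands that contain t *)
  proof (induction t arbitrary: F rule: wfp_induct_rule[OF wfp_lex_less[of m n \<sigma>]])
    case (1 t)
    note outer = "1.IH"
    show ?case
      using "1.prems"
    proof (induction "card {i. i < k \<and> t \<in> Poly_Mapping.keys (F i)}" arbitrary: F rule: less_induct)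
      case less
      note F = less.prems(2) and f_eq = less.prems(3) and le_t = less.prems(4)
      let ?T = "\<lambda>F. {i. i < k \<and> t \<in> Poly_Mapping.keys (F i)}"
      have lead_F: "lead_monomial \<sigma> (F i) = t" "F i \<noteq> 0" if "i \<in> ?T F" for i
        using that le_t by (auto intro!: lead_monomial_eqI)
      show ?case
      proof (cases "t \<in> Poly_Mapping.keys f")
        case True
        then have "lead_monomial \<sigma> f = t"
          using le_t subsetD[OF keys_f[OF f_eq]] by (intro lead_monomial_eqI) blast+
        moreover obtain i where "i \<in> ?T F"
          using True keys_f[OF f_eq] by blast
        ultimately show ?thesis
          using lead_F F by (metis (mono_tags, lifting) mem_Collect_eq)
      next
        case t_f: False
        show ?thesis
        proof (cases "?T F = {}")
          case True
          (* the greatest monomial of the summands is a smaller bound *)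
          have "?supp F \<noteq> {}"
            using keys_f[OF f_eq] f(2) keys_eq_empty[of f] by blast
          moreover have "asymp_on (?supp F) (lex_less \<sigma>)" "transp_on (?supp F) (lex_less \<sigma>)"
            by (metis asymp_onI lex_less_irrefl lex_less_trans) (metis transp_onI lex_less_trans)
          ultimately obtain t' where t': "t' \<in> ?supp F"
            "\<forall>s\<in>?supp F. s \<noteq> t' \<longrightarrow> \<not> lex_less \<sigma> t' s"
            using Finite_Set.bex_max_element[of "?supp F" "lex_less \<sigma>"] by auto
          have "s = t' \<or> lex_less \<sigma> s t'" if "s \<in> ?supp F" for s
            using that t'(2) lex_less_total by blast
          moreover have "t' \<noteq> t" "?E t'"
            using True t'(1) supp_entries[OF t'(1) F] by auto
          ultimately show ?thesis
            using outer[of t' F] less.prems t'(1) by blast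
        next
          case False
          then obtain i where i: "i < k" "t \<in> Poly_Mapping.keys (F i)" by blast
          have "(\<Sum>j<k. Poly_Mapping.lookup (F j) t) = 0"
            using t_f f_eq by (simp add: in_keys_iff lookup_sum)
          moreover have "Poly_Mapping.lookup (F i) t \<noteq> 0"
            using i by (simp add: in_keys_iff)
          ultimately have "(\<Sum>j\<in>{..<k} - {i}. Poly_Mapping.lookup (F j) t) \<noteq> 0"
            using i(1) by (auto simp: sum.remove[of "{..<k}" i])
          then obtain j where j: "j < k" "j \<noteq> i" "t \<in> Poly_Mapping.keys (F j)"
            by (metis (no_types, lifting) Diff_iff in_keys_iff insert_iff lessThan_iff sum.neutral)
          have "\<exists>h\<in>I i \<inter> I j. h \<noteq> 0 \<and> lead_monomial \<sigma> h = lead_monomial \<sigma> (F i)"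
            using i j F lead_F by (intro common) auto
          then obtain h where h: "h \<in> I i" "h \<in> I j" "h \<noteq> 0" "lead_monomial \<sigma> h = t"
            using lead_F(1)[of i] i by auto
          have t_h: "Poly_Mapping.lookup h t \<noteq> 0"
            using lead_monomial_in_keys[OF h(3), of \<sigma>] h(4) by (simp add: in_keys_iff)
          define c where "c = Poly_Mapping.lookup (F i) t / Poly_Mapping.lookup h t"
          define g where "g = Poly_Mapping.single 0 c * h"
          have lookup_g: "Poly_Mapping.lookup g s = c * Poly_Mapping.lookup h s" for s
            using lookup_single_times[of 0 c h s] by (simp add: g_def)
          have g: "g \<in> I i" "- g \<in> I i" "g \<in> I j"
            using ideal_mult[OF ideal constant_in_carrier, of _ h c]
              ideal_mult[OF ideal constant_in_carrier, of _ h "- c"] h i j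
            by (simp_all add: g_def single_uminus)
          have g_le: "s = t \<or> lex_less \<sigma> s t" if "s \<in> Poly_Mapping.keys g" for s
            using that lead_monomial_greatest[OF h(3), of s \<sigma>] h(4) by (auto simp: in_keys_iff lookup_g)
          define F' where "F' = F(i := F i + - g, j := F j + g)"
          have F'_ij: "F' i = F i + - g" "F' j = F j + g" and F'_other: "\<And>l. l \<noteq> i \<Longrightarrow> l \<noteq> j \<Longrightarrow> F' l = F l"
            using j(2) by (simp_all add: F'_def)
          have "F' i \<in> I i" "F' j \<in> I j"
            unfolding F'_ij using F g i j by (auto intro!: ideal_add[OF ideal] simp del: add_uminus_conv_diff)
          then have F': "F' l \<in> I l" if "l < k" for l
            using that F F'_other by (cases "l = i"; cases "l = j") auto
          have "(\<Sum>l<k. F' l) = F' i + F' j + (\<Sum>l\<in>{..<k} - {i} - {j}. F' l)"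
            using i(1) j(1,2) by (simp add: sum.remove[of _ i] sum.remove[of _ j] add.assoc)
          also have "(\<Sum>l\<in>{..<k} - {i} - {j}. F' l) = (\<Sum>l\<in>{..<k} - {i} - {j}. F l)"
            by (intro sum.cong) (auto simp: F'_other)
          also have "F' i + F' j + \<dots> = F i + F j + (\<Sum>l\<in>{..<k} - {i} - {j}. F l)"
            by (simp add: F'_ij)
          also have "\<dots> = (\<Sum>l<k. F l)"
            using i(1) j(1,2) by (simp add: sum.remove[of _ i] sum.remove[of _ j] add.assoc)
          finally have f_eq': "f = (\<Sum>l<k. F' l)"
            using f_eq by simp
          have keys_F': "Poly_Mapping.keys (F' l) \<subseteq> Poly_Mapping.keys (F l) \<union> Poly_Mapping.keys g" for l
            using Poly_Mapping.keys_add[of "F i" "- g"] Poly_Mapping.keys_add[of "F j" g]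
            by (cases "l = i"; cases "l = j") (auto simp: F'_ij F'_other)
          have le_t': "s = t \<or> lex_less \<sigma> s t" if "s \<in> ?supp F'" for s
            using that keys_F' le_t g_le by blast
          have "Poly_Mapping.lookup (F' i) t = 0"
            using t_h by (simp add: F'_ij lookup_minus lookup_g c_def)
          then have "i \<notin> ?T F'"
            by (simp add: in_keys_iff)
          moreover have "?T F' \<subseteq> ?T F"
            using \<open>i \<notin> ?T F'\<close> F'_other i j by (auto intro: ccontr) metis
          ultimately have "?T F' \<subset> ?T F"
            using i by blast
          then have "card (?T F') < card (?T F)"
            by (intro psubset_card_mono) auto
          then show ?thesis
            using less.hyps[of F'] less.prems(1) F' f_eq' le_t' by blast
        qed
      qed
    qed
  qed
  have "?supp F \<noteq> {}"
    using keys_f[OF f(1)] f(2) keys_eq_empty[of f] by blast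
  moreover have "asymp_on (?supp F) (lex_less \<sigma>)" "transp_on (?supp F) (lex_less \<sigma>)"
    by (metis asymp_onI lex_less_irrefl lex_less_trans) (metis transp_onI lex_less_trans)
  ultimately obtain t where t: "t \<in> ?supp F" "\<forall>s\<in>?supp F. s \<noteq> t \<longrightarrow> \<not> lex_less \<sigma> t s"
    using Finite_Set.bex_max_element[of "?supp F" "lex_less \<sigma>"] by auto
  have "s = t \<or> lex_less \<sigma> s t" if "s \<in> ?supp F" for s
    using that t(2) lex_less_total by blast
  then show ?thesis
    using main[of t F] F f(1) supp_entries[OF t(1) F] by blast
qed

text \<open>Only common multiples of leading monomials of generators need to be considered, because
  these divide all leading monomials of the ideals, and only an \<open>h\<close> whose leading monomial
  divides \<open>t\<close> is needed, because \<open>h\<close> can be multiplied by the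
  quotient.\<close>

lemma groebner_basis_UN:
  fixes G :: "nat \<Rightarrow> 'a::field mpoly set"
  assumes gb: "\<And>i. i < k \<Longrightarrow> groebner_basis m n \<sigma> (G i) (Idl\<^bsub>poly_ring m n\<^esub> (G i))"
    and carrier: "\<And>i. i < k \<Longrightarrow> G i \<subseteq> carrier (poly_ring m n)"
    and common: "\<And>i j p q t. i < k \<Longrightarrow> j < k \<Longrightarrow> i \<noteq> j \<Longrightarrow> p \<in> G i \<Longrightarrow> q \<in> G j \<Longrightarrow> p \<noteq> 0 \<Longrightarrow> q \<noteq> 0 \<Longrightarrow>
      \<exists>u. t = lead_monomial \<sigma> p + u \<Longrightarrow> \<exists>u. t = lead_monomial \<sigma> q + u \<Longrightarrow>
      \<exists>h \<in> Idl\<^bsub>poly_ring m n\<^esub> (G i) \<inter> Idl\<^bsub>poly_ring m n\<^esub> (G j).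
        h \<noteq> 0 \<and> (\<exists>u. t = lead_monomial \<sigma> h + u)"
  shows "groebner_basis m n \<sigma> (\<Union>i<k. G i) (Idl\<^bsub>poly_ring m n\<^esub> (\<Union>i<k. G i))"
proof -
  let ?G = "\<Union>i<k. G i" and ?I = "\<lambda>i. Idl\<^bsub>poly_ring m n\<^esub> (G i)"
  have G: "?G \<subseteq> carrier (poly_ring m n)"
    using carrier by blast
  then have I: "Idl\<^bsub>poly_ring m n\<^esub> ?G \<subseteq> carrier (poly_ring m n)"
    using ideal_carrier[OF ideal_Idl] by blast
  have Ii: "?I i \<subseteq> carrier (poly_ring m n)" if "i < k" for i
    using ideal_carrier[OF ideal_Idl] carrier that by blast
  have in_Ii: "initial_ideal m n \<sigma> (?I i) = initial_ideal m n \<sigma> (G i)" if "i < k" for i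
    using gb[OF that] by (simp add: groebner_basis_def)
  have divides: "\<exists>g\<in>G i. g \<noteq> 0 \<and> (\<exists>u. lead_monomial \<sigma> p = lead_monomial \<sigma> g + u)"
    if "i < k" "p \<in> ?I i" "p \<noteq> 0" for i p
  proof -
    have "lead_term \<sigma> p \<in> initial_ideal m n \<sigma> (G i)"
      using lead_term_in_initial_ideal[OF Ii] in_Ii that by blast
    moreover have "lead_monomial \<sigma> p \<in> Poly_Mapping.keys (lead_term \<sigma> p)"
      using lead_monomial_in_keys[OF that(3), of \<sigma>] by (simp add: lead_term_def in_keys_iff)
    ultimately show ?thesis
      using initial_ideal_divisible carrier[OF that(1)] by metis
  qed
  have common': "\<exists>h\<in>?I i \<inter> ?I j. h \<noteq> 0 \<and> lead_monomial \<sigma> h = lead_monomial \<sigma> p"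
    if ij: "i < k" "j < k" "i \<noteq> j" and p: "p \<in> ?I i" "p \<noteq> 0" and q: "q \<in> ?I j" "q \<noteq> 0"
      and eq: "lead_monomial \<sigma> p = lead_monomial \<sigma> q" for i j p q
  proof -
    obtain g g' where "g \<in> G i" "g \<noteq> 0" "\<exists>u. lead_monomial \<sigma> p = lead_monomial \<sigma> g + u"
      and "g' \<in> G j" "g' \<noteq> 0" "\<exists>u. lead_monomial \<sigma> p = lead_monomial \<sigma> g' + u"
      using divides[OF ij(1) p] divides[OF ij(2) q] eq by metis
    from common[OF ij this(1,4,2,5,3,6)] obtain h u where h: "h \<in> ?I i" "h \<in> ?I j" "h \<noteq> 0"
      and u: "lead_monomial \<sigma> p = lead_monomial \<sigma> h + u"
      by blast
    have "Poly_Mapping.keys u \<subseteq> Poly_Mapping.keys (lead_monomial \<sigma> p)"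
      unfolding u by (auto simp: in_keys_iff lookup_add)
    then have "Poly_Mapping.single u 1 \<in> carrier (poly_ring m n)"
      using lead_monomial_keys[of p m n \<sigma>] p Ii[OF ij(1)] by (intro monomial_in_carrier) blast
    then have "Poly_Mapping.single u 1 * h \<in> ?I i \<inter> ?I j"
      using h ij carrier by (auto intro!: ideal_mult[OF ideal_Idl])
    moreover have "lead_monomial \<sigma> (Poly_Mapping.single u 1 * h) = lead_monomial \<sigma> p"
      using lead_monomial_single_times[OF h(3), of 1 \<sigma> u] u by (simp add: add.commute)
    moreover have "Poly_Mapping.single u 1 * h \<noteq> 0"
      using lookup_single_times[of u 1 h "lead_monomial \<sigma> h"] lead_monomial_in_keys[OF h(3), of \<sigma>]
      by (auto simp: in_keys_iff)
    ultimately show ?thesis by blast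
  qed
  have "lead_term \<sigma> f \<in> initial_ideal m n \<sigma> ?G"
    if f: "f \<in> Idl\<^bsub>poly_ring m n\<^esub> ?G" "f \<noteq> 0" for f
  proof -
    obtain F where F: "\<And>i. i < k \<Longrightarrow> F i \<in> ?I i" "f = (\<Sum>i<k. F i)"
      using Idl_UN_cases[OF carrier f(1)] by blast
    have "\<exists>i<k. \<exists>p\<in>?I i. p \<noteq> 0 \<and> lead_monomial \<sigma> p = lead_monomial \<sigma> f"
      using ideal_Idl[OF carrier] common' F f(2) by (rule lead_monomial_sum_ideals)
    then obtain i p where i: "i < k" and p: "p \<in> ?I i" "p \<noteq> 0"
      and eq: "lead_monomial \<sigma> p = lead_monomial \<sigma> f"
      by blast
    define c where "c = Poly_Mapping.lookup f (lead_monomial \<sigma> f) / Poly_Mapping.lookup p (lead_monomial \<sigma> p)"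
    have "lead_term \<sigma> p \<in> initial_ideal m n \<sigma> (G i)"
      using lead_term_in_initial_ideal[OF Ii[OF i] p, of \<sigma>] in_Ii[OF i] by simp
    then have "lead_term \<sigma> p \<in> initial_ideal m n \<sigma> ?G"
      using initial_ideal_mono[OF _ G, of "G i" \<sigma>] i by blast
    then have "Poly_Mapping.single 0 c * lead_term \<sigma> p \<in> initial_ideal m n \<sigma> ?G"
      by (intro ideal_mult[OF ideal_initial_ideal[OF G]] constant_in_carrier)
    also have "Poly_Mapping.single 0 c * lead_term \<sigma> p = lead_term \<sigma> f"
      using lead_monomial_in_keys[OF p(2), of \<sigma>]
      by (simp add: lead_term_def mult_single eq c_def in_keys_iff)
    finally show ?thesis .
  qed
  then have "initial_ideal m n \<sigma> (Idl\<^bsub>poly_ring m n\<^esub> ?G) \<subseteq> initial_ideal m n \<sigma> ?G"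
    unfolding initial_ideal_def[of m n \<sigma> "Idl\<^bsub>poly_ring m n\<^esub> ?G"]
    by (intro Idl_least[OF ideal_initial_ideal[OF G]]) blast
  moreover have "initial_ideal m n \<sigma> ?G \<subseteq> initial_ideal m n \<sigma> (Idl\<^bsub>poly_ring m n\<^esub> ?G)"
    by (rule initial_ideal_mono[OF Idl_superset[OF G] I])
  moreover have "finite ?G"
    using gb by (simp add: groebner_basis_def)
  ultimately show ?thesis
    unfolding groebner_basis_def using Idl_superset[OF G] by blast
qed

section \<open>Determinants of matrices of variables\<close>

definition indet :: "pos \<Rightarrow> 'a::field mpoly" where
  "indet v = Poly_Mapping.single (Poly_Mapping.single v 1) 1"

lemma indet_in_carrier: "v \<in> entries m n \<Longrightarrow> indet v \<in> carrier (poly_ring m n)"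
  unfolding indet_def by (intro monomial_in_carrier) simp

lemma prod_indet:
  "(\<Prod>k\<in>K. indet (v k)) = Poly_Mapping.single (\<Sum>k\<in>K. Poly_Mapping.single (v k) 1) 1"
  by (induction K rule: infinite_finite_induct) (auto simp: indet_def mult_single)

text \<open>All indices moved by a permutation \<open>p\<close> contribute, to the term of
  \<open>p\<close>, variables less than the greatest variable which they contribute to the diagonal
  term; the other indices contribute the same to both.\<close>

lemma lex_less_permuted_diagonal:
  fixes R C :: "nat \<Rightarrow> nat"
  assumes p: "k0 < N" "p k0 \<noteq> k0"
    and greater: "\<And>k. k < N \<Longrightarrow> p k \<noteq> k \<Longrightarrow>
      \<exists>l<N. p l \<noteq> l \<and> var_greater \<sigma> (R l, C l) (R k, C (p k))"
  shows "lex_less \<sigma> (\<Sum>k<N. Poly_Mapping.single (R k, C (p k)) 1)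
    (\<Sum>k<N. Poly_Mapping.single (R k, C k) 1)"
proof -
  define M where "M = {k. k < N \<and> p k \<noteq> k}"
  define V where "V = (\<lambda>k. (R k, C k)) ` M"
  have M: "finite M" "k0 \<in> M" "M \<subseteq> {..<N}"
    using p by (auto simp: M_def)
  then have "finite V" "V \<noteq> {}"
    by (auto simp: V_def)
  moreover have "asymp_on V (var_greater \<sigma>)" "transp_on V (var_greater \<sigma>)"
    by (metis asymp_onI var_greater_irrefl var_greater_trans)
      (metis transp_onI var_greater_trans)
  ultimately obtain v where v: "v \<in> V" "\<forall>w\<in>V. w \<noteq> v \<longrightarrow> \<not> var_greater \<sigma> w v"
    using Finite_Set.bex_min_element[of V "var_greater \<sigma>"] by blast
  have less: "var_greater \<sigma> v (R k, C (p k))" if "k \<in> M" for k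
  proof -
    obtain l where l: "l \<in> M" "var_greater \<sigma> (R l, C l) (R k, C (p k))"
      using greater[of k] \<open>k \<in> M\<close> by (auto simp: M_def)
    then have "(R l, C l) = v \<or> var_greater \<sigma> v (R l, C l)"
      using v var_greater_total[of "(R l, C l)" v \<sigma>] by (auto simp: V_def)
    with l(2) var_greater_trans show ?thesis by metis
  qed
  let ?a = "\<lambda>w k. if (R k, C k) = w then 1 else 0 :: nat"
  let ?b = "\<lambda>w k. if (R k, C (p k)) = w then 1 else 0 :: nat"
  have split: "sum f {..<N} = sum f ({..<N} - M) + sum f M" for f :: "nat \<Rightarrow> nat"
    using M by (intro sum.subset_diff) auto
  have same: "sum (?b w) ({..<N} - M) = sum (?a w) ({..<N} - M)" for w
    by (intro sum.cong) (auto simp: M_def)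
  have zero: "sum (?b w) M = 0" if "w = v \<or> var_greater \<sigma> w v" for w
    using that less var_greater_irrefl var_greater_trans by (intro sum.neutral) metis
  have zero': "sum (?a w) M = 0" if "var_greater \<sigma> w v" for w
  proof (intro sum.neutral ballI)
    fix k assume "k \<in> M"
    then have "(R k, C k) \<in> V"
      by (auto simp: V_def)
    with v(2) that var_greater_irrefl[of \<sigma> v] have "(R k, C k) \<noteq> w"
      by metis
    then show "?a w k = 0"
      by simp
  qed
  obtain k where "k \<in> M" "v = (R k, C k)"
    using v(1) by (auto simp: V_def)
  then have "sum (?a v) M > 0"
    using M(1) by (intro sum_pos2[of M k]) auto
  then have "sum (?b v) {..<N} < sum (?a v) {..<N}"
    unfolding split same using zero[of v] by simp
  moreover have "sum (?b w) {..<N} = sum (?a w) {..<N}" if "var_greater \<sigma> w v" for w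
    unfolding split same using zero zero' that by simp
  ultimately show ?thesis
    unfolding lex_less_def
    by (intro exI[of _ v]) (simp add: lookup_sum lookup_single when_def del: split_paired_All One_nat_def)
qed

text \<open>By \<open>lex_less_permuted_diagonal\<close>, the diagonal term of the Leibniz formula does
  not cancel and is the leading term. The predicate \<open>nz\<close> tells where the matrix has a
  variable; the other entries are 0.\<close>

lemma lead_monomial_det:
  fixes N :: nat and R C :: "nat \<Rightarrow> nat" and nz :: "nat \<Rightarrow> nat \<Rightarrow> bool"
  defines "Z \<equiv> mat N N (\<lambda>(k, l). if nz k l then indet (R k, C l) else 0) :: 'a::field mpoly mat"
  assumes diagonal: "\<And>k. k < N \<Longrightarrow> nz k k"
    and greater: "\<And>p k. p permutes {..<N} \<Longrightarrow> \<forall>l<N. nz l (p l) \<Longrightarrow> k < N \<Longrightarrow> p k \<noteq> k \<Longrightarrow>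
      \<exists>l<N. p l \<noteq> l \<and> var_greater \<sigma> (R l, C l) (R k, C (p k))"
  shows "det Z \<noteq> 0" and "lead_monomial \<sigma> (det Z) = (\<Sum>k<N. Poly_Mapping.single (R k, C k) 1)"
proof -
  define mono where "mono p = (\<Sum>k<N. Poly_Mapping.single (R k, C (p k)) (1::nat))" for p :: "nat \<Rightarrow> nat"
  define Q where "Q = {p. p permutes {..<N} \<and> (\<forall>l<N. nz l (p l))}"
  have "det Z = (\<Sum>p | p permutes {..<N}. of_int (sign p) * (\<Prod>k<N. Z $$ (k, p k)))"
    by (subst det_def'[of Z N]) (simp_all add: Z_def atLeast0LessThan)
  also have "\<dots> = (\<Sum>p\<in>Q. of_int (sign p) * (\<Prod>k<N. Z $$ (k, p k)))"
  proof (intro sum.mono_neutral_right ballI)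
    fix p assume "p \<in> {p. p permutes {..<N}} - Q"
    then obtain k where p: "p permutes {..<N}" and k: "k < N" "\<not> nz k (p k)"
      by (auto simp: Q_def)
    then have "Z $$ (k, p k) = 0"
      using permutes_in_image[OF p, of k] by (simp add: Z_def)
    then have "(\<Prod>k<N. Z $$ (k, p k)) = 0"
      using k(1) by (intro prod_zero) auto
    then show "of_int (sign p) * (\<Prod>k<N. Z $$ (k, p k)) = 0"
      by simp
  qed (auto simp: Q_def finite_permutations)
  also have "\<dots> = (\<Sum>p\<in>Q. Poly_Mapping.single (mono p) (of_int (sign p)))"
  proof (intro sum.cong refl)
    fix p assume p: "p \<in> Q"
    then have "(\<Prod>k<N. Z $$ (k, p k)) = (\<Prod>k<N. indet (R k, C (p k)))"
      by (intro prod.cong) (auto simp: Z_def Q_def permutes_in_image[of p "{..<N}", simplified])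
    then show "of_int (sign p) * (\<Prod>k<N. Z $$ (k, p k)) = Poly_Mapping.single (mono p) (of_int (sign p))"
      by (simp add: prod_indet mono_def mult_single flip: single_of_int)
  qed
  finally have det: "det Z = (\<Sum>p\<in>Q. Poly_Mapping.single (mono p) (of_int (sign p)))" .
  have less: "lex_less \<sigma> (mono p) (mono id)" if "p \<in> Q" "p \<noteq> id" for p
  proof -
    obtain k0 where "p k0 \<noteq> k0"
      using \<open>p \<noteq> id\<close> by (auto simp: fun_eq_iff)
    moreover from this have "k0 < N"
      using \<open>p \<in> Q\<close> by (auto simp: Q_def permutes_def)
    ultimately show ?thesis
      using \<open>p \<in> Q\<close> greater[of p] lex_less_permuted_diagonal[of k0 N p \<sigma> R C]
      unfolding mono_def Q_def id_apply by blast
  qed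
  have Q: "finite Q" "id \<in> Q"
    using diagonal by (auto simp: Q_def permutes_id finite_permutations[of "{..<N}"])
  have "Poly_Mapping.lookup (det Z) (mono id) =
      (\<Sum>p\<in>Q. if p = id then of_int (sign p) else 0)"
    unfolding det lookup_sum
  proof (intro sum.cong refl)
    fix p assume "p \<in> Q"
    then have "mono p = mono id \<longleftrightarrow> p = id"
      using less[of p] lex_less_irrefl by metis
    then show "Poly_Mapping.lookup (Poly_Mapping.single (mono p) (of_int (sign p))) (mono id) =
        (if p = id then of_int (sign p) else 0 :: 'a)"
      by (simp add: lookup_single when_def)
  qed
  also have "\<dots> = 1"
    using Q by (simp add: sum.delta')
  finally have id: "mono id \<in> Poly_Mapping.keys (det Z)"
    by (simp add: in_keys_iff)
  then show "det Z \<noteq> 0" by auto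
  have "s = mono id \<or> lex_less \<sigma> s (mono id)" if "s \<in> Poly_Mapping.keys (det Z)" for s
  proof -
    have "s \<in> (\<Union>p\<in>Q. Poly_Mapping.keys (Poly_Mapping.single (mono p) (of_int (sign p) :: 'a)))"
      using that unfolding det by (rule subsetD[OF keys_sum])
    then obtain p where "p \<in> Q" "s = mono p"
      by (auto split: if_splits)
    with less show ?thesis by metis
  qed
  with id have "lead_monomial \<sigma> (det Z) = mono id"
    by (rule lead_monomial_eqI)
  then show "lead_monomial \<sigma> (det Z) = (\<Sum>k<N. Poly_Mapping.single (R k, C k) 1)"
    by (simp add: mono_def)
qed

text \<open>Expansion along the last row removes the rows that are not among the first \<open>r\<close>
  one by one.\<close>

lemma det_in_ideal_first_rows:
  fixes A :: "'a::field mpoly mat"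
  assumes J: "ideal J (poly_ring m n)" and "A \<in> carrier_mat N N" and "r \<le> N"
    and "\<And>i j. i < N \<Longrightarrow> j < N \<Longrightarrow> A $$ (i, j) \<in> carrier (poly_ring m n)"
    and "\<And>g. (\<And>j. j < r \<Longrightarrow> g j < N) \<Longrightarrow> det (mat r r (\<lambda>(i, j). A $$ (i, g j))) \<in> J"
  shows "det A \<in> J"
  using assms(3,2,4,5)
proof (induction N arbitrary: A rule: dec_induct)
  case base
  then have "mat r r (\<lambda>(i, j). A $$ (i, id j)) = A"
    by (intro eq_matI) auto
  with base.prems(3)[of id] show ?case by simp
next
  case (step N)
  note A = step.prems(1) and carrier = step.prems(2) and minors = step.prems(3)
  have "det (mat_delete A N j) \<in> J" if j: "j < Suc N" for j
  proof (rule step.IH)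
    show "mat_delete A N j \<in> carrier_mat N N"
      using A by (auto simp: mat_delete_def)
    show "mat_delete A N j $$ (i, l) \<in> carrier (poly_ring m n)" if "i < N" "l < N" for i l
      using that j A carrier by (auto simp: mat_delete_def)
  next
    fix g :: "nat \<Rightarrow> nat" assume g: "\<And>j. j < r \<Longrightarrow> g j < N"
    define g' where "g' l = (if g l < j then g l else Suc (g l))" for l
    have "mat r r (\<lambda>(i, l). mat_delete A N j $$ (i, g l)) = mat r r (\<lambda>(i, l). A $$ (i, g' l))"
      using g step.hyps A by (intro eq_matI) (auto simp: mat_delete_def g'_def)
    moreover have "g' l < Suc N" if "l < r" for l
      using g[OF that] by (simp add: g'_def)
    ultimately show "det (mat r r (\<lambda>(i, l). mat_delete A N j $$ (i, g l))) \<in> J"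
      using minors by metis
  qed
  then have "A $$ (N, j) * cofactor A N j \<in> J" if "j < Suc N" for j
  proof -
    have "(- 1) ^ (N + j) = (of_int ((- 1) ^ (N + j)) :: 'a mpoly)"
      by simp
    then have "(- 1) ^ (N + j) \<in> carrier (poly_ring m n :: 'a mpoly ring)"
      using of_int_in_carrier by metis
    with that show ?thesis
      unfolding cofactor_def by (intro ideal_mult[OF J] carrier) (use \<open>\<And>j. j < Suc N \<Longrightarrow> det (mat_delete A N j) \<in> J\<close> in auto)
  qed
  then show ?case
    unfolding laplace_expansion_row[OF A lessI] by (intro ideal_sum[OF J]) auto
qed

lemma sign_times_sign: "of_int (sign p) * (of_int (sign p) * x) = (x :: 'a::ring_1)"
  by (cases p rule: sign_cases) simp_all

text \<open>The rows \<open>p 0\<close>, ..., \<open>p (r - 1)\<close> can be made the first ones by a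
  permutation, which only changes the sign.\<close>

lemma det_in_ideal_rows:
  fixes A :: "'a::field mpoly mat"
  assumes J: "ideal J (poly_ring m n)" and A: "A \<in> carrier_mat N N" and r: "r \<le> N"
    and carrier: "\<And>i j. i < N \<Longrightarrow> j < N \<Longrightarrow> A $$ (i, j) \<in> carrier (poly_ring m n)"
    and p: "p permutes {..<N}"
    and minors: "\<And>g. (\<And>j. j < r \<Longrightarrow> g j < N) \<Longrightarrow> det (mat r r (\<lambda>(i, j). A $$ (p i, g j))) \<in> J"
  shows "det A \<in> J"
proof -
  define A' where "A' = mat N N (\<lambda>(i, j). A $$ (p i, j))"
  have p_lt: "p i < N" if "i < N" for i
    using permutes_in_image[OF p, of i] that by simp
  have "det A' \<in> J"
  proof (rule det_in_ideal_first_rows[OF J _ r])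
    show "A' $$ (i, j) \<in> carrier (poly_ring m n)" if "i < N" "j < N" for i j
      using that p_lt carrier by (simp add: A'_def)
  next
    fix g :: "nat \<Rightarrow> nat" assume g: "\<And>j. j < r \<Longrightarrow> g j < N"
    have "mat r r (\<lambda>(i, j). A' $$ (i, g j)) = mat r r (\<lambda>(i, j). A $$ (p i, g j))"
      using g r by (intro eq_matI) (auto simp: A'_def)
    with minors[of g] g show "det (mat r r (\<lambda>(i, j). A' $$ (i, g j))) \<in> J"
      by simp
  qed (simp add: A'_def)
  then have "of_int (sign p) * det A' \<in> J"
    by (intro ideal_mult[OF J] of_int_in_carrier)
  also have "det A' = of_int (sign p) * det A"
    unfolding A'_def using A p by (intro det_permute_rows) (simp_all add: atLeast0LessThan)
  finally show ?thesis
    by (simp add: sign_times_sign)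
qed

lemma det_in_ideal_columns:
  fixes A :: "'a::field mpoly mat"
  assumes J: "ideal J (poly_ring m n)" and A: "A \<in> carrier_mat N N" and r: "r \<le> N"
    and carrier: "\<And>i j. i < N \<Longrightarrow> j < N \<Longrightarrow> A $$ (i, j) \<in> carrier (poly_ring m n)"
    and p: "p permutes {..<N}"
    and minors: "\<And>g. (\<And>j. j < r \<Longrightarrow> g j < N) \<Longrightarrow> det (mat r r (\<lambda>(i, j). A $$ (g i, p j))) \<in> J"
  shows "det A \<in> J"
proof -
  have p_lt: "p i < N" if "i < N" for i
    using permutes_in_image[OF p, of i] that by simp
  have "det (A\<^sup>T) \<in> J"
  proof (rule det_in_ideal_rows[OF J _ r _ p])
    fix g :: "nat \<Rightarrow> nat" assume g: "\<And>j. j < r \<Longrightarrow> g j < N"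
    have "mat r r (\<lambda>(i, j). A\<^sup>T $$ (p i, g j)) = (mat r r (\<lambda>(i, j). A $$ (g i, p j)))\<^sup>T"
      using g r A p_lt by (intro eq_matI) auto
    with minors[of g] g show "det (mat r r (\<lambda>(i, j). A\<^sup>T $$ (p i, g j))) \<in> J"
      by (simp add: det_transpose[of _ r])
  qed (use A carrier in auto)
  with A show ?thesis
    by (simp add: det_transpose)
qed

lemma det_in_carrier:
  fixes A :: "'a::field mpoly mat"
  assumes "A \<in> carrier_mat N N"
    and "\<And>i j. i < N \<Longrightarrow> j < N \<Longrightarrow> A $$ (i, j) \<in> carrier (poly_ring m n)"
  shows "det A \<in> carrier (poly_ring m n)"
  (* the carrier is an ideal, and the 0-minor 1 lies in it *)
  using assms of_int_in_carrier[of 1 m n]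
  by (intro det_in_ideal_first_rows[OF ring.oneideal[OF ring_poly_ring] assms(1), of 0]) auto

section \<open>Minors of the generic matrix\<close>

lemma submatrix_generic_matrix:
  assumes "I \<subseteq> {..<m}" "J \<subseteq> {..<n}" "card I = r" "card J = r"
  shows "submatrix (generic_matrix m n) I J = mat r r (\<lambda>(i, j). indet (pick I i, pick J j))"
proof -
  have "{i. i < m \<and> i \<in> I} = I" "{j. j < n \<and> j \<in> J} = J"
    using assms by auto
  moreover have "pick I i < m" "pick J i < n" if "i < r" for i
    using pick_in_set_le[of i I] pick_in_set_le[of i J] that assms by auto
  ultimately show ?thesis
    using assms unfolding submatrix_def generic_matrix_def
    by (intro eq_matI) (auto simp: indet_def)
qed

lemma minors_in_eq:
  "minors_in m n r B = {det (mat r r (\<lambda>(i, j). indet (pick I i, pick J j))) | I J.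
     I \<subseteq> {..<m} \<and> J \<subseteq> {..<n} \<and> card I = r \<and> card J = r \<and> I \<times> J \<subseteq> B}"
  unfolding minors_in_def
  by (intro Collect_cong ex_cong1, rule iffI; elim conjE;
      simp add: submatrix_generic_matrix[where r = r])

lemma minors_in_carrier: "minors_in m n r B \<subseteq> carrier (poly_ring m n)"
proof
  fix p :: "'a mpoly" assume "p \<in> minors_in m n r B"
  then obtain I J where p: "p = det (mat r r (\<lambda>(i, j). indet (pick I i, pick J j)))"
    and IJ: "I \<subseteq> {..<m}" "J \<subseteq> {..<n}" "card I = r" "card J = r"
    unfolding minors_in_eq by blast
  have "(pick I i, pick J j) \<in> entries m n" if "i < r" "j < r" for i j
    using pick_in_set_le[of i I] pick_in_set_le[of j J] that IJ by (auto simp: entries_def)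
  then show "p \<in> carrier (poly_ring m n)"
    unfolding p by (intro det_in_carrier[where N = r]) (auto intro: indet_in_carrier)
qed

lemma pick_permutation:
  fixes P :: "nat \<Rightarrow> nat"
  assumes "inj_on P {..<r}"
  obtains p where "p permutes {..<r}" "\<And>i. i < r \<Longrightarrow> pick (P ` {..<r}) (p i) = P i"
proof -
  let ?I = "P ` {..<r}"
  define p where "p i = (if i < r then card {a \<in> ?I. a < P i} else i)" for i
  have pick: "pick ?I (p i) = P i" if "i < r" for i
    using that pick_card_in_set[of "P i" ?I] by (simp add: p_def)
  have "p i < r" if "i < r" for i
  proof -
    have "{a \<in> ?I. a < P i} \<subset> ?I"
      using that by auto
    then have "card {a \<in> ?I. a < P i} < card ?I"
      by (intro psubset_card_mono) auto
    then show ?thesis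
      using that card_image[OF assms] by (simp add: p_def)
  qed
  then have "p ` {..<r} \<subseteq> {..<r}"
    by auto
  moreover have "inj_on p {..<r}"
    using assms pick unfolding inj_on_def by (metis lessThan_iff)
  ultimately have "bij_betw p {..<r} {..<r}"
    by (simp add: bij_betw_def endo_inj_surj)
  then have "p permutes {..<r}"
    by (intro bij_imp_permutes) (auto simp: p_def)
  with pick that show thesis by blast
qed

text \<open>Rows and columns may be selected in any order and repeatedly: this changes the sign of a
  minor or makes it vanish.\<close>

lemma det_indet_in_Idl_minors:
  fixes P Q :: "nat \<Rightarrow> nat"
  assumes B: "\<And>i j. i < r \<Longrightarrow> j < r \<Longrightarrow> (P i, Q j) \<in> B \<inter> entries m n"
  shows "(det (mat r r (\<lambda>(i, j). indet (P i, Q j))) :: 'a::field mpoly) \<in> Idl\<^bsub>poly_ring m n\<^esub> (minors_in m n r B)"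
    (is "det ?A \<in> ?I")
proof -
  have I: "ideal ?I (poly_ring m n)"
    by (rule ideal_Idl[OF minors_in_carrier])
  consider (rows) "\<not> inj_on P {..<r}" | (columns) "\<not> inj_on Q {..<r}"
    | (inj) "inj_on P {..<r}" "inj_on Q {..<r}"
    by blast
  then show ?thesis
  proof cases
    case rows
    then obtain i i' where i: "i < r" "i' < r" "i \<noteq> i'" "P i = P i'"
      by (auto simp: inj_on_def)
    then have "row ?A i = row ?A i'"
      by (intro eq_vecI) auto
    then have "det ?A = 0"
      using i by (intro det_identical_rows[of ?A r i i']) auto
    then show ?thesis
      using ideal_zero[OF I] by simp
  next
    case columns
    then obtain i i' where i: "i < r" "i' < r" "i \<noteq> i'" "Q i = Q i'"
      by (auto simp: inj_on_def)
    then have "col ?A i = col ?A i'"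
      by (intro eq_vecI) auto
    then have "det ?A = 0"
      using i by (intro det_identical_columns[of ?A r i i']) auto
    then show ?thesis
      using ideal_zero[OF I] by simp
  next
    case inj
    let ?I = "P ` {..<r}" and ?J = "Q ` {..<r}"
    obtain p where p: "p permutes {..<r}" "\<And>i. i < r \<Longrightarrow> pick ?I (p i) = P i"
      using pick_permutation[OF inj(1)] by blast
    obtain q where q: "q permutes {..<r}" "\<And>i. i < r \<Longrightarrow> pick ?J (q i) = Q i"
      using pick_permutation[OF inj(2)] by blast
    define S :: "'a mpoly mat" where "S = mat r r (\<lambda>(i, j). indet (pick ?I i, pick ?J j))"
    have "?I \<subseteq> {..<m}" "?J \<subseteq> {..<n}" "?I \<times> ?J \<subseteq> B"
      using B by (auto simp: entries_def)
    moreover have "card ?I = r" "card ?J = r"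
      using inj by (simp_all add: card_image)
    ultimately have "det S \<in> minors_in m n r B"
      unfolding minors_in_eq S_def by blast
    then have S: "det S \<in> Idl\<^bsub>poly_ring m n\<^esub> (minors_in m n r B)"
      using Idl_superset[OF minors_in_carrier] by blast
    define T where "T = mat r r (\<lambda>(i, j). S\<^sup>T $$ (q i, j))"
    have lt: "p i < r" "q i < r" if "i < r" for i
      using that permutes_in_image[OF p(1)] permutes_in_image[OF q(1)] by auto
    have "?A = mat r r (\<lambda>(i, j). T\<^sup>T $$ (p i, j))"
      by (intro eq_matI) (auto simp: T_def S_def lt p(2) q(2))
    also have "det \<dots> = of_int (sign p) * det (T\<^sup>T)"
      using p(1) by (intro det_permute_rows) (simp_all add: T_def atLeast0LessThan)
    also have "det (T\<^sup>T) = det T"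
      by (rule det_transpose[of _ r]) (simp add: T_def)
    also have "det T = of_int (sign q) * det (S\<^sup>T)"
      using q(1) unfolding T_def by (intro det_permute_rows) (simp_all add: S_def atLeast0LessThan)
    also have "det (S\<^sup>T) = det S"
      by (rule det_transpose[of _ r]) (simp add: S_def)
    finally have "det ?A = of_int (sign p) * (of_int (sign q) * det S)" .
    then show ?thesis
      using S by (simp add: ideal_mult[OF I] of_int_in_carrier)
  qed
qed

section \<open>Pairs of diagonals\<close>

definition chain :: "nat \<Rightarrow> (nat \<Rightarrow> pos) \<Rightarrow> bool" where
  "chain r \<alpha> \<longleftrightarrow> (\<forall>j<r. \<forall>i<j. fst (\<alpha> i) < fst (\<alpha> j) \<and> snd (\<alpha> i) < snd (\<alpha> j))"

definition northeast :: "pos \<Rightarrow> pos \<Rightarrow> bool" where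
  "northeast v w \<longleftrightarrow> fst v \<le> fst w \<and> snd w \<le> snd v \<and> v \<noteq> w"

lemma chainD: "chain r \<alpha> \<Longrightarrow> i < j \<Longrightarrow> j < r \<Longrightarrow> fst (\<alpha> i) < fst (\<alpha> j) \<and> snd (\<alpha> i) < snd (\<alpha> j)"
  by (simp add: chain_def)

lemma chain_leD:
  assumes "chain r \<alpha>" "i \<le> j" "j < r"
  shows "fst (\<alpha> i) \<le> fst (\<alpha> j) \<and> snd (\<alpha> i) \<le> snd (\<alpha> j)"
  using assms chainD[of r \<alpha> i j] by (cases "i = j") auto

lemma chain_replace_prefix:
  assumes "chain r \<alpha>" "chain s \<beta>" "t < s"
    and less: "Suc t < r \<Longrightarrow> fst (\<beta> t) < fst (\<alpha> (Suc t)) \<and> snd (\<beta> t) < snd (\<alpha> (Suc t))"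
  shows "chain r (\<lambda>i. if i \<le> t then \<beta> i else \<alpha> i)"
  unfolding chain_def
proof (intro allI impI)
  fix i j assume ij: "j < r" "i < j"
  consider "j \<le> t" | "i \<le> t" "t < j" | "t < i"
    by linarith
  then show "fst (if i \<le> t then \<beta> i else \<alpha> i) < fst (if j \<le> t then \<beta> j else \<alpha> j) \<and>
      snd (if i \<le> t then \<beta> i else \<alpha> i) < snd (if j \<le> t then \<beta> j else \<alpha> j)"
  proof cases
    case 2
    then show ?thesis
      using ij assms(3) less chain_leD[OF assms(2), of i t] chain_leD[OF assms(1), of "Suc t" j] by auto
  qed (use ij assms(3) chainD[OF assms(1), of i j] chainD[OF assms(2), of i j] in auto)
qed

locale uncrossed_chains =
  fixes r s e :: nat and \<alpha> \<beta> :: "nat \<Rightarrow> pos"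
  assumes chain_\<alpha>: "chain r \<alpha>" and chain_\<beta>: "chain s \<beta>"
    and e_le_r: "e \<le> r" and e_le_s: "e \<le> s"
    and common: "\<And>i. i < e \<Longrightarrow> \<alpha> i = \<beta> i"
    and uncrossed: "\<And>i. e \<le> i \<Longrightarrow> i < r \<Longrightarrow> i < s \<Longrightarrow> northeast (\<alpha> i) (\<beta> i)"

text \<open>Consider the last index \<open>t\<close> at which the first chain is not strictly northeast
  of the second one. At \<open>t\<close> the two chains are comparable, or the first one is southwest of
  the second one and they cross directly after \<open>t\<close> unless one of them ends. In each case
  one of the chains can take over the initial segment of the other one up to \<open>t\<close>. The
  bounds persist: if the initial segment of the first chain is replaced, then its element at
  \<open>t\<close> does not move south, and if that of the second chain is replaced, then its element at
  \<open>t\<close> does not move east.\<close>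

lemma uncross_chains:
  fixes \<alpha> \<beta> :: "nat \<Rightarrow> pos"
  assumes \<alpha>: "chain r \<alpha>" "\<And>i. i < r \<Longrightarrow> fst (\<alpha> i) \<le> a"
    and \<beta>: "chain s \<beta>" "\<And>i. i < s \<Longrightarrow> snd (\<beta> i) \<le> b"
  obtains \<alpha>' \<beta>' e where "uncrossed_chains r s e \<alpha>' \<beta>'"
    and "\<forall>i<r. fst (\<alpha>' i) \<le> a" "\<forall>i<s. snd (\<beta>' i) \<le> b"
    and "\<alpha>' ` {..<r} \<union> \<beta>' ` {..<s} \<subseteq> \<alpha> ` {..<r} \<union> \<beta> ` {..<s}"
proof -
  define bad where "bad = {i. i < r \<and> i < s \<and> \<not> northeast (\<alpha> i) (\<beta> i)}"
  have "finite bad"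
    unfolding bad_def by (rule finite_subset[of _ "{..<r}"]) auto
  show thesis
  proof (cases "bad = {}")
    case True
    then have "northeast (\<alpha> i) (\<beta> i)" if "i < r" "i < s" for i
      using that by (auto simp: bad_def)
    with assms show thesis
      by (intro that[of 0 \<alpha> \<beta>] uncrossed_chains.intro) auto
  next
    case False
    define t where "t = Max bad"
    have "t \<in> bad"
      using False \<open>finite bad\<close> by (simp add: t_def)
    then have t: "t < r" "t < s" "\<not> northeast (\<alpha> t) (\<beta> t)"
      by (auto simp: bad_def)
    have ne: "northeast (\<alpha> i) (\<beta> i)" if "t < i" "i < r" "i < s" for i
    proof (rule ccontr)
      assume "\<not> ?thesis"
      with that have "i \<in> bad" by (simp add: bad_def)
      then have "i \<le> t" using \<open>finite bad\<close> by (simp add: t_def)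
      with \<open>t < i\<close> show False by simp
    qed
    define A where "A \<longleftrightarrow> fst (\<beta> t) \<le> a \<and>
      (Suc t < r \<longrightarrow> fst (\<beta> t) < fst (\<alpha> (Suc t)) \<and> snd (\<beta> t) < snd (\<alpha> (Suc t)))"
    define B where "B \<longleftrightarrow> snd (\<alpha> t) \<le> b \<and>
      (Suc t < s \<longrightarrow> fst (\<alpha> t) < fst (\<beta> (Suc t)) \<and> snd (\<alpha> t) < snd (\<beta> (Suc t)))"
    have next_\<alpha>: "fst (\<alpha> t) < fst (\<alpha> (Suc t)) \<and> snd (\<alpha> t) < snd (\<alpha> (Suc t))" if "Suc t < r"
      using chainD[OF \<alpha>(1), of t "Suc t"] that by simp
    have next_\<beta>: "fst (\<beta> t) < fst (\<beta> (Suc t)) \<and> snd (\<beta> t) < snd (\<beta> (Suc t))" if "Suc t < s"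
      using chainD[OF \<beta>(1), of t "Suc t"] that by simp
    have next_ne: "fst (\<alpha> (Suc t)) \<le> fst (\<beta> (Suc t)) \<and> snd (\<beta> (Suc t)) \<le> snd (\<alpha> (Suc t))"
      if "Suc t < r" "Suc t < s"
      using ne[of "Suc t"] that by (simp add: northeast_def)
    have bounds: "fst (\<alpha> t) \<le> a" "snd (\<beta> t) \<le> b"
      using t \<alpha>(2) \<beta>(2) by auto
    consider "fst (\<alpha> t) \<le> fst (\<beta> t)" "snd (\<alpha> t) \<le> snd (\<beta> t)"
      | "fst (\<beta> t) \<le> fst (\<alpha> t)" "snd (\<beta> t) \<le> snd (\<alpha> t)"
      | "fst (\<beta> t) \<le> fst (\<alpha> t)" "snd (\<alpha> t) \<le> snd (\<beta> t)"
      using t(3) by (metis linear northeast_def order_refl)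
    then have "A \<or> B"
    proof cases
      case 3
      (* the first chain is southwest of the second one at t, but northeast of it at t + 1, if both reach t + 1 *)
      then show ?thesis
        using next_\<alpha> next_\<beta> next_ne bounds unfolding A_def B_def
        by (cases "Suc t < r"; cases "Suc t < s") auto
    qed (use bounds next_\<alpha> next_\<beta> in \<open>force simp: A_def B_def\<close>)+
    then show thesis
    proof
      assume A
      let ?\<alpha> = "\<lambda>i. if i \<le> t then \<beta> i else \<alpha> i"
      have "chain r ?\<alpha>"
        using \<open>A\<close> t chain_replace_prefix[OF \<alpha>(1) \<beta>(1), of t] by (simp add: A_def)
      then have "uncrossed_chains r s (Suc t) ?\<alpha> \<beta>"
        using \<beta>(1) t ne by unfold_locales auto
      moreover have "fst (?\<alpha> i) \<le> a" if "i < r" for i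
        using \<open>A\<close> t that \<alpha>(2)[OF that] chain_leD[OF \<beta>(1), of i t] by (auto simp: A_def)
      moreover have "?\<alpha> ` {..<r} \<subseteq> \<alpha> ` {..<r} \<union> \<beta> ` {..<s}"
        using t by auto
      ultimately show thesis
        using \<beta>(2) by (intro that[of "Suc t" ?\<alpha> \<beta>]) auto
    next
      assume B
      let ?\<beta> = "\<lambda>i. if i \<le> t then \<alpha> i else \<beta> i"
      have "chain s ?\<beta>"
        using \<open>B\<close> t chain_replace_prefix[OF \<beta>(1) \<alpha>(1), of t] by (simp add: B_def)
      then have "uncrossed_chains r s (Suc t) \<alpha> ?\<beta>"
        using \<alpha>(1) t ne by unfold_locales auto
      moreover have "snd (?\<beta> i) \<le> b" if "i < s" for i
        using \<open>B\<close> t that \<beta>(2)[OF that] chain_leD[OF \<alpha>(1), of i t] by (auto simp: B_def)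
      moreover have "?\<beta> ` {..<s} \<subseteq> \<alpha> ` {..<r} \<union> \<beta> ` {..<s}"
        using t by auto
      ultimately show thesis
        using \<alpha>(2) by (intro that[of "Suc t" \<alpha> ?\<beta>]) auto
    qed
  qed
qed

section \<open>The determinant of two minors with a common initial segment\<close>

lemma var_greater_NW:
  "\<sigma> \<in> {NW_by_rows, NW_by_columns} \<Longrightarrow> i \<le> i' \<Longrightarrow> j \<le> j' \<Longrightarrow> i \<noteq> i' \<or> j \<noteq> j' \<Longrightarrow>
    var_greater \<sigma> (i, j) (i', j')"
  by auto

lemma var_greater_SE:
  "\<sigma> \<in> {SE_by_rows, SE_by_columns} \<Longrightarrow> i' \<le> i \<Longrightarrow> j' \<le> j \<Longrightarrow> i \<noteq> i' \<or> j \<noteq> j' \<Longrightarrow>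
    var_greater \<sigma> (i, j) (i', j')"
  by auto

context uncrossed_chains
begin

definition glued_dim :: nat where
  "glued_dim = r + (s - e)"

text \<open>The union of the two chains: \<open>\<alpha>\<close> occupies the indices below
  \<open>r\<close>, and \<open>\<beta>\<close> occupies the indices below \<open>e\<close> and those
  from \<open>r\<close> on.\<close>

definition \<gamma> :: "nat \<Rightarrow> pos" where
  "\<gamma> k = (if k < r then \<alpha> k else \<beta> (k - r + e))"

definition nonzero :: "nat \<Rightarrow> nat \<Rightarrow> bool" where
  "nonzero k l \<longleftrightarrow> \<not> (r \<le> k \<and> e \<le> l \<and> l < r)"

text \<open>Row \<open>k\<close> and column \<open>l\<close> carry the row of \<open>\<gamma> k\<close>
  and the column of \<open>\<gamma> l\<close>, so that the diagonal lists \<open>\<gamma>\<close>. The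
  zero block keeps the rows of the second part of \<open>\<beta>\<close> apart from the columns of the
  second part of \<open>\<alpha>\<close>, since the variables at their intersections may lie in neither
  of the two rectangles. The same matrix row may occur once for \<open>\<alpha>\<close> and once for
  \<open>\<beta>\<close>, with different zeros.\<close>

definition glued :: "'a::field mpoly mat" where
  "glued = mat glued_dim glued_dim (\<lambda>(k, l). if nonzero k l then indet (fst (\<gamma> k), snd (\<gamma> l)) else 0)"

lemma \<gamma>_less:
  assumes "k < l" "l < glued_dim" and "l < r \<or> (k < e \<or> r \<le> k) \<and> r \<le> l"
  shows "fst (\<gamma> k) < fst (\<gamma> l) \<and> snd (\<gamma> k) < snd (\<gamma> l)"
proof (cases "l < r")
  case True
  with assms show ?thesis
    using chainD[OF chain_\<alpha>, of k l] by (simp add: \<gamma>_def)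
next
  case False
  define k' where "k' = (if k < e then k else k - r + e)"
  have k': "\<gamma> k = \<beta> k'"
    using assms False common e_le_r by (auto simp: \<gamma>_def k'_def)
  have "k' < l - r + e" "l - r + e < s"
    using assms False e_le_s e_le_r by (auto simp: k'_def glued_dim_def)
  then show ?thesis
    unfolding k' using chainD[OF chain_\<beta>, of k' "l - r + e"] False by (simp add: \<gamma>_def)
qed

text \<open>Let \<open>p\<close> move \<open>k\<close> to \<open>l\<close>. If \<open>\<gamma> k\<close>
  and \<open>\<gamma> l\<close> belong to the same chain, then the smaller of them, for the orders from
  the northwest, or the larger one, for those from the southeast, is the required greater diagonal
  entry. The only other case which the zero block permits is that \<open>\<gamma> k\<close> belongs to
  the second part of \<open>\<alpha>\<close> and \<open>\<gamma> l\<close> to that of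
  \<open>\<beta>\<close>. From the northwest, an entry of the common part is greater, and one of these
  is moved: otherwise only the rows of the second part of \<open>\<alpha>\<close> would be left for the
  equally many columns of this part, so that row \<open>k\<close> would have to use one of them. From
  the southeast, \<open>\<gamma> k\<close> or \<open>\<gamma> l\<close> is greater because
  \<open>\<alpha>\<close> is northeast of \<open>\<beta>\<close>.\<close>

lemma greater_moved_diagonal_entry:
  assumes p: "p permutes {..<glued_dim}" and nz: "\<forall>l<glued_dim. nonzero l (p l)"
    and k: "k < glued_dim" "p k \<noteq> k"
  shows "\<exists>l<glued_dim. p l \<noteq> l \<and> var_greater \<sigma> (fst (\<gamma> l), snd (\<gamma> l)) (fst (\<gamma> k), snd (\<gamma> (p k)))"
proof -
  define l where "l = p k"
  have l: "l < glued_dim" "p l \<noteq> l" "l \<noteq> k"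
    using permutes_in_image[OF p, of k] permutes_inj[OF p] k by (auto simp: l_def dest: injD)
  have NW_or_SE: "\<sigma> \<in> {NW_by_rows, NW_by_columns} \<or> \<sigma> \<in> {SE_by_rows, SE_by_columns}"
    by (cases \<sigma>) auto
  have comparable: ?thesis if "max k l < r \<or> (min k l < e \<or> r \<le> min k l) \<and> r \<le> max k l"
  proof -
    let ?min = "min k l" and ?max = "max k l"
    have less: "fst (\<gamma> ?min) < fst (\<gamma> ?max)" "snd (\<gamma> ?min) < snd (\<gamma> ?max)"
      using \<gamma>_less[of ?min ?max] that k(1) l by (auto simp: min_def max_def)
    have moved: "?min < glued_dim" "p ?min \<noteq> ?min" "?max < glued_dim" "p ?max \<noteq> ?max"
      using k l by (auto simp: min_def max_def)
    show ?thesis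
    proof (cases "\<sigma> \<in> {NW_by_rows, NW_by_columns}")
      case True
      then have "var_greater \<sigma> (fst (\<gamma> ?min), snd (\<gamma> ?min)) (fst (\<gamma> k), snd (\<gamma> l))"
        using less by (intro var_greater_NW) (auto simp: min_def max_def split: if_splits)
      then show ?thesis
        using moved unfolding l_def[symmetric] by blast
    next
      case False
      with NW_or_SE have "var_greater \<sigma> (fst (\<gamma> ?max), snd (\<gamma> ?max)) (fst (\<gamma> k), snd (\<gamma> l))"
        using less by (intro var_greater_SE) (auto simp: min_def max_def split: if_splits)
      then show ?thesis
        using moved unfolding l_def[symmetric] by blast
    qed
  qed
  have not_back: "\<not> (r \<le> k \<and> e \<le> l \<and> l < r)"
    using nz k(1) unfolding nonzero_def l_def by blast
  show ?thesis
  proof (cases "e \<le> k \<and> k < r \<and> r \<le> l")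
    case False
    with not_back l(3) show ?thesis
      by (intro comparable) (auto simp: min_def max_def)
  next
    case True
    define j where "j = l - r + e"
    have j: "e \<le> j" "j < s" "\<gamma> l = \<beta> j"
      using True l(1) e_le_s by (auto simp: j_def \<gamma>_def glued_dim_def)
    have \<gamma>_k: "\<gamma> k = \<alpha> k"
      using True by (simp add: \<gamma>_def)
    show ?thesis
    proof (cases "\<sigma> \<in> {NW_by_rows, NW_by_columns}")
      case NW: True
      have "\<exists>i<e. p i \<noteq> i"
      proof (rule ccontr)
        assume "\<not> ?thesis"
        then have fixed: "p i = i" if "i < e" for i
          using that by blast
        have "i \<in> {e..<r}" if "p i \<in> {e..<r}" for i
        proof -
          have "i < glued_dim"
            using permutes_in_image[OF p, of i] that by (auto simp: glued_dim_def)
          with nz that have "i < r"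
            by (auto simp: nonzero_def not_le)
          with that fixed show ?thesis
            by (metis atLeastLessThan_iff not_le)
        qed
        then have "inv_into UNIV p ` {e..<r} \<subseteq> {e..<r}"
          using permutes_inverses(1)[OF p] by (metis image_subsetI)
        then have "inv_into UNIV p ` {e..<r} = {e..<r}"
          using permutes_inj_on[OF permutes_inv[OF p]] by (intro endo_inj_surj) auto
        moreover have "k \<in> {e..<r}"
          using True by simp
        ultimately obtain i where "i \<in> {e..<r}" "k = inv_into UNIV p i"
          by blast
        then have "l \<in> {e..<r}"
          using permutes_inverses(1)[OF p] by (simp add: l_def)
        with True show False by simp
      qed
      then obtain i where i: "i < e" "p i \<noteq> i" by blast
      have "fst (\<gamma> i) < fst (\<gamma> k)" "snd (\<gamma> i) < snd (\<gamma> l)"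
        using \<gamma>_less[of i k] \<gamma>_less[of i l] i(1) True k(1) l(1) e_le_r by auto
      with NW have "var_greater \<sigma> (fst (\<gamma> i), snd (\<gamma> i)) (fst (\<gamma> k), snd (\<gamma> l))"
        by (intro var_greater_NW) auto
      with i e_le_r show ?thesis
        unfolding l_def[symmetric] by (intro exI[of _ i]) (auto simp: glued_dim_def)
    next
      case False
      with NW_or_SE have SE: "\<sigma> \<in> {SE_by_rows, SE_by_columns}" by blast
      have "var_greater \<sigma> (fst (\<gamma> l), snd (\<gamma> l)) (fst (\<gamma> k), snd (\<gamma> l)) \<or>
          var_greater \<sigma> (fst (\<gamma> k), snd (\<gamma> k)) (fst (\<gamma> k), snd (\<gamma> l))"
      proof (cases "k < s")
        case k_s: True
        have ne: "northeast (\<alpha> k) (\<beta> k)"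
          using uncrossed[of k] True k_s by blast
        consider "k < j" | "j < k" | "j = k" by linarith
        then show ?thesis
        proof cases
          case 1
          then have "fst (\<alpha> k) < fst (\<beta> j)"
            using chainD[OF chain_\<beta>, of k j] j(2) ne by (auto simp: northeast_def)
          then show ?thesis
            using SE by (intro disjI1 var_greater_SE) (auto simp: j(3) \<gamma>_k)
        next
          case 2
          then have "snd (\<beta> j) < snd (\<alpha> k)"
            using chainD[OF chain_\<beta>, of j k] k_s ne by (auto simp: northeast_def)
          then show ?thesis
            using SE by (intro disjI2 var_greater_SE) (auto simp: j(3) \<gamma>_k)
        next
          case 3
          with ne have "fst (\<alpha> k) < fst (\<beta> j) \<or> snd (\<beta> j) < snd (\<alpha> k)"
            by (auto simp: northeast_def prod_eq_iff)
          then show ?thesis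
            using SE ne 3 var_greater_SE[OF SE, of "fst (\<alpha> k)" "fst (\<beta> j)" "snd (\<beta> j)" "snd (\<beta> j)"]
              var_greater_SE[OF SE, of "fst (\<alpha> k)" "fst (\<alpha> k)" "snd (\<beta> j)" "snd (\<alpha> k)"]
            by (auto simp: j(3) \<gamma>_k northeast_def)
        qed
      next
        case False
        have "snd (\<beta> j) \<le> snd (\<alpha> j)"
          using uncrossed[of j] j True False by (auto simp: northeast_def)
        also have "\<dots> < snd (\<alpha> k)"
          using chainD[OF chain_\<alpha>, of j k] True False j(2) by auto
        finally show ?thesis
          using SE by (intro disjI2 var_greater_SE) (auto simp: j(3) \<gamma>_k)
      qed
      with k l show ?thesis
        unfolding l_def by blast
    qed
  qed
qed

lemma det_glued_nonzero: "det (glued :: 'a::field mpoly mat) \<noteq> 0"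
  and lead_monomial_det_glued:
    "lead_monomial \<sigma> (det (glued :: 'a mpoly mat)) = (\<Sum>k<glued_dim. Poly_Mapping.single (\<gamma> k) 1)"
proof -
  have "nonzero k k" for k
    by (auto simp: nonzero_def)
  from lead_monomial_det[where nz = nonzero and R = "\<lambda>k. fst (\<gamma> k)" and C = "\<lambda>k. snd (\<gamma> k)",
      OF this greater_moved_diagonal_entry]
  show "det (glued :: 'a mpoly mat) \<noteq> 0"
    "lead_monomial \<sigma> (det (glued :: 'a mpoly mat)) = (\<Sum>k<glued_dim. Poly_Mapping.single (\<gamma> k) 1)"
    unfolding glued_def by simp_all
qed

end

context uncrossed_chains
begin

lemma glued_entry:
  "k < glued_dim \<Longrightarrow> l < glued_dim \<Longrightarrow>
    glued $$ (k, l) = (if nonzero k l then indet (fst (\<gamma> k), snd (\<gamma> l)) else 0)"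
  by (simp add: glued_def)

lemma glued_in_carrier_mat: "glued \<in> carrier_mat glued_dim glued_dim"
  by (simp add: glued_def)

lemma \<gamma>_cases:
  assumes "k < glued_dim"
  obtains (alpha) i where "i < r" "\<gamma> k = \<alpha> i" | (beta) j where "j < s" "\<gamma> k = \<beta> j"
proof (cases "k < r")
  case True
  then show thesis
    using that(1)[of k] by (simp add: \<gamma>_def)
next
  case False
  with assms have "k - r + e < s"
    using e_le_s by (simp add: glued_dim_def)
  with False show thesis
    using that(2)[of "k - r + e"] by (simp add: \<gamma>_def)
qed

lemma inj_on_\<gamma>: "inj_on \<gamma> {..<glued_dim}"
proof (rule linorder_inj_onI)
  fix k l assume kl: "k < l" "k \<in> {..<glued_dim}" "l \<in> {..<glued_dim}"
  show "\<gamma> k \<noteq> \<gamma> l"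
  proof (cases "l < r \<or> (k < e \<or> r \<le> k) \<and> r \<le> l")
    case True
    then show ?thesis
      using \<gamma>_less[of k l] kl by auto
  next
    case False
    define j where "j = l - r + e"
    have *: "e \<le> k" "k < r" "\<gamma> k = \<alpha> k" "e \<le> j" "j < s" "\<gamma> l = \<beta> j"
      using False kl e_le_s by (auto simp: \<gamma>_def j_def glued_dim_def)
    consider "k < s" "k = j" | "k < s" "k < j" | "j < k"
      using * by linarith
    then show ?thesis
    proof cases
      case 3
      (* the column of \<gamma> k is greater: compare at index k, or at index j if \<beta> ends before k *)
      show ?thesis
      proof (cases "k < s")
        case True
        then show ?thesis
          using uncrossed[of k] chainD[OF chain_\<beta>, of j k] 3 * by (auto simp: northeast_def)
      next
        case False
        then show ?thesis
          using uncrossed[of j] chainD[OF chain_\<alpha>, of j k] 3 * by (auto simp: northeast_def)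
      qed
    qed (use uncrossed[of k] chainD[OF chain_\<beta>, of k j] * in \<open>auto simp: northeast_def\<close>)
  qed
qed auto

text \<open>The rows of \<open>\<alpha>\<close> and the columns of \<open>\<beta>\<close> contain no
  zeros, so that the maximal minors of these rows or columns are minors of the generic matrix.\<close>

lemma det_glued_in_Idl_rows:
  assumes entries: "\<And>k l. k < glued_dim \<Longrightarrow> l < glued_dim \<Longrightarrow> nonzero k l \<Longrightarrow> (fst (\<gamma> k), snd (\<gamma> l)) \<in> entries m n"
    and B: "\<And>k l. k < r \<Longrightarrow> l < glued_dim \<Longrightarrow> (fst (\<gamma> k), snd (\<gamma> l)) \<in> B"
  shows "det (glued :: 'a::field mpoly mat) \<in> Idl\<^bsub>poly_ring m n\<^esub> (minors_in m n r B)"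
proof (rule det_in_ideal_first_rows[OF ideal_Idl[OF minors_in_carrier] glued_in_carrier_mat])
  show "r \<le> glued_dim"
    by (simp add: glued_dim_def)
  show "glued $$ (k, l) \<in> carrier (poly_ring m n)" if "k < glued_dim" "l < glued_dim" for k l
    using that entries by (simp add: glued_entry indet_in_carrier in_carrier_iff[of 0])
next
  fix g :: "nat \<Rightarrow> nat" assume g: "\<And>j. j < r \<Longrightarrow> g j < glued_dim"
  have "mat r r (\<lambda>(i, j). glued $$ (i, g j)) =
      (mat r r (\<lambda>(i, j). indet (fst (\<gamma> i), snd (\<gamma> (g j)))) :: 'a mpoly mat)"
    using g by (intro eq_matI) (auto simp: glued_entry nonzero_def glued_dim_def)
  moreover have "(fst (\<gamma> i), snd (\<gamma> (g j))) \<in> B \<inter> entries m n" if "i < r" "j < r" for i j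
    using that g entries[of i "g j"] B by (auto simp: nonzero_def glued_dim_def)
  ultimately show "det (mat r r (\<lambda>(i, j). glued $$ (i, g j)) :: 'a mpoly mat) \<in>
      Idl\<^bsub>poly_ring m n\<^esub> (minors_in m n r B)"
    by (simp add: det_indet_in_Idl_minors)
qed

lemma det_glued_in_Idl_columns:
  assumes entries: "\<And>k l. k < glued_dim \<Longrightarrow> l < glued_dim \<Longrightarrow> nonzero k l \<Longrightarrow> (fst (\<gamma> k), snd (\<gamma> l)) \<in> entries m n"
    and B: "\<And>k j. k < glued_dim \<Longrightarrow> j < s \<Longrightarrow> (fst (\<gamma> k), snd (\<beta> j)) \<in> B"
  shows "det (glued :: 'a::field mpoly mat) \<in> Idl\<^bsub>poly_ring m n\<^esub> (minors_in m n s B)"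
proof -
  (* lists the indices of \<beta> first *)
  define p where "p i = (if i < e then i else if i < s then i - e + r else if i < glued_dim then i - s + e else i)" for i
  have \<gamma>_p: "\<gamma> (p j) = \<beta> j" if "j < s" for j
    using that e_le_r common by (auto simp: \<gamma>_def p_def)
  have nonzero_p: "nonzero k (p j)" if "j < s" for j k
    using that e_le_r by (auto simp: nonzero_def p_def)
  have "p i < glued_dim" if "i < glued_dim" for i
    using that e_le_s by (auto simp: p_def glued_dim_def)
  then have "p ` {..<glued_dim} \<subseteq> {..<glued_dim}"
    by auto
  moreover have "inj_on p {..<glued_dim}"
  proof (rule inj_onI)
    show "i = j" if "i \<in> {..<glued_dim}" "j \<in> {..<glued_dim}" "p i = p j" for i j
      using that e_le_r e_le_s by (simp add: p_def glued_dim_def split: if_splits)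
  qed
  ultimately have "bij_betw p {..<glued_dim} {..<glued_dim}"
    by (simp add: bij_betw_def endo_inj_surj)
  moreover have "p i = i" if "i \<notin> {..<glued_dim}" for i
    using that e_le_r e_le_s by (auto simp: p_def glued_dim_def)
  ultimately have p: "p permutes {..<glued_dim}"
    by (rule bij_imp_permutes)
  then have p_lt: "p i < glued_dim" if "i < glued_dim" for i
    using permutes_in_image[OF p, of i] that by simp
  have s: "s \<le> glued_dim"
    using e_le_r e_le_s by (simp add: glued_dim_def)
  show ?thesis
  proof (rule det_in_ideal_columns[OF ideal_Idl[OF minors_in_carrier] glued_in_carrier_mat s _ p])
    show "glued $$ (k, l) \<in> carrier (poly_ring m n)" if "k < glued_dim" "l < glued_dim" for k l
      using that entries by (simp add: glued_entry indet_in_carrier in_carrier_iff[of 0])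
  next
    fix g :: "nat \<Rightarrow> nat" assume g: "\<And>j. j < s \<Longrightarrow> g j < glued_dim"
    have "mat s s (\<lambda>(i, j). glued $$ (g i, p j)) =
        (mat s s (\<lambda>(i, j). indet (fst (\<gamma> (g i)), snd (\<beta> j))) :: 'a mpoly mat)"
      using g p_lt s nonzero_p by (intro eq_matI) (auto simp: glued_entry \<gamma>_p)
    moreover have "(fst (\<gamma> (g i)), snd (\<beta> j)) \<in> B \<inter> entries m n" if "i < s" "j < s" for i j
      using that g p_lt[of j] s entries[of "g i" "p j"] nonzero_p B by (auto simp: \<gamma>_p)
    ultimately show "det (mat s s (\<lambda>(i, j). glued $$ (g i, p j)) :: 'a mpoly mat) \<in>
        Idl\<^bsub>poly_ring m n\<^esub> (minors_in m n s B)"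
      by (simp add: det_indet_in_Idl_minors)
  qed
qed

end

section \<open>Minors in ladders\<close>

text \<open>The diagonal of a minor is a chain: this is the case of a glued matrix without second
  parts.\<close>

lemma minor_lead_monomial:
  fixes p :: "'a::field mpoly"
  assumes "p \<in> minors_in m n r B"
  obtains \<alpha> where "chain r \<alpha>" "lead_monomial \<sigma> p = (\<Sum>k<r. Poly_Mapping.single (\<alpha> k) 1)"
    and "\<And>i j. i < r \<Longrightarrow> j < r \<Longrightarrow> (fst (\<alpha> i), snd (\<alpha> j)) \<in> B"
proof -
  obtain I J where p: "p = det (mat r r (\<lambda>(i, j). indet (pick I i, pick J j)))"
    and IJ: "I \<subseteq> {..<m}" "J \<subseteq> {..<n}" "card I = r" "card J = r" "I \<times> J \<subseteq> B"
    using assms unfolding minors_in_eq by blast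
  define \<alpha> where "\<alpha> i = (pick I i, pick J i)" for i
  have "pick I i \<in> I" "pick J i \<in> J" if "i < r" for i
    using pick_in_set_le[of i I] pick_in_set_le[of i J] that IJ by auto
  then have "(fst (\<alpha> i), snd (\<alpha> j)) \<in> B" if "i < r" "j < r" for i j
    using that IJ by (auto simp: \<alpha>_def)
  moreover have chain: "chain r \<alpha>"
    unfolding chain_def \<alpha>_def using pick_mono_le[of _ I] pick_mono_le[of _ J] IJ by auto
  moreover have "lead_monomial \<sigma> p = (\<Sum>k<r. Poly_Mapping.single (\<alpha> k) 1)"
  proof -
    interpret uncrossed_chains r r r \<alpha> \<alpha>
      using chain by unfold_locales auto
    have "glued = (mat r r (\<lambda>(i, j). indet (pick I i, pick J j)) :: 'a mpoly mat)"
      by (intro eq_matI) (auto simp: glued_def glued_dim_def nonzero_def \<gamma>_def \<alpha>_def)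
    then show ?thesis
      using lead_monomial_det_glued[where 'a = 'a, of \<sigma>] unfolding p by (simp add: glued_dim_def \<gamma>_def)
  qed
  ultimately show thesis
    using that by blast
qed

lemma poly_mapping_le_imp_diff:
  fixes s t :: monomial
  assumes "\<And>v. Poly_Mapping.lookup s v \<le> Poly_Mapping.lookup t v"
  shows "t = s + (t - s)"
  by (rule poly_mapping_eqI) (simp add: lookup_add lookup_minus assms)

text \<open>Uncrossing uses only positions of the two given chains, and \<open>\<gamma>\<close> is
  injective, so that the squarefree leading monomial of the glued determinant divides
  \<open>t\<close>.\<close>

lemma common_multiple_of_diagonals:
  fixes \<alpha> \<beta> :: "nat \<Rightarrow> pos" and t :: monomial
  assumes \<alpha>: "chain r \<alpha>" "\<And>i. i < r \<Longrightarrow> \<alpha> i \<in> {c..a} \<times> {d..b}"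
    and \<beta>: "chain s \<beta>" "\<And>i. i < s \<Longrightarrow> \<beta> i \<in> {c..a'} \<times> {d..b'}"
    and crossing: "a \<le> a'" "b' \<le> b"
    and A: "{c..a} \<times> {d..b} \<subseteq> A \<inter> entries m n"
    and B: "{c..a'} \<times> {d..b'} \<subseteq> B \<inter> entries m n"
    and t\<alpha>: "t = (\<Sum>k<r. Poly_Mapping.single (\<alpha> k) 1) + x"
    and t\<beta>: "t = (\<Sum>k<s. Poly_Mapping.single (\<beta> k) 1) + y"
  shows "\<exists>h \<in> Idl\<^bsub>poly_ring m n\<^esub> (minors_in m n r A) \<inter> Idl\<^bsub>poly_ring m n\<^esub> (minors_in m n s B).
    (h :: 'a::field mpoly) \<noteq> 0 \<and> (\<exists>u. t = lead_monomial \<sigma> h + u)"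
proof -
  have "\<And>i. i < r \<Longrightarrow> fst (\<alpha> i) \<le> a" "\<And>i. i < s \<Longrightarrow> snd (\<beta> i) \<le> b'"
    using \<alpha>(2) \<beta>(2) by (auto simp: mem_Times_iff)
  then obtain \<alpha>' \<beta>' e where uncrossed: "uncrossed_chains r s e \<alpha>' \<beta>'"
    and bounds: "\<forall>i<r. fst (\<alpha>' i) \<le> a" "\<forall>i<s. snd (\<beta>' i) \<le> b'"
    and range: "\<alpha>' ` {..<r} \<union> \<beta>' ` {..<s} \<subseteq> \<alpha> ` {..<r} \<union> \<beta> ` {..<s}"
    using uncross_chains[OF \<alpha>(1) _ \<beta>(1)] by metis
  interpret uncrossed_chains r s e \<alpha>' \<beta>'
    by (rule uncrossed)
  have \<gamma>_range: "\<gamma> k \<in> \<alpha> ` {..<r} \<union> \<beta> ` {..<s}" if "k < glued_dim" for k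
    using that range by (cases k rule: \<gamma>_cases) blast+
  have rectangle: "\<gamma> k \<in> {c..a'} \<times> {d..b}" if "k < glued_dim" for k
    using \<gamma>_range[OF that] \<alpha>(2) \<beta>(2) crossing by (force simp: mem_Times_iff)
  have rows: "fst (\<gamma> k) \<le> a" if "k < r" for k
    using that bounds by (simp add: \<gamma>_def)
  have columns: "snd (\<gamma> l) \<le> b'" if "l < glued_dim" "l < e \<or> r \<le> l" for l
    using that bounds e_le_r e_le_s common by (auto simp: \<gamma>_def glued_dim_def)
  have in_A: "(fst (\<gamma> k), snd (\<gamma> l)) \<in> A \<inter> entries m n" if "k < r" "l < glued_dim" for k l
    using that rectangle[of k] rectangle[of l] rows[of k] A by (auto simp: glued_dim_def mem_Times_iff)
  have in_B: "(fst (\<gamma> k), snd (\<gamma> l)) \<in> B \<inter> entries m n" if "k < glued_dim" "l < glued_dim" "l < e \<or> r \<le> l" for k l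
    using that rectangle[of k] rectangle[of l] columns[of l] B by (auto simp: mem_Times_iff)
  have in_B': "(fst (\<gamma> k), snd (\<beta>' j)) \<in> B" if "k < glued_dim" "j < s" for k j
  proof -
    have "\<beta>' j \<in> \<alpha> ` {..<r} \<union> \<beta> ` {..<s}"
      using range that(2) by blast
    then have "d \<le> snd (\<beta>' j)"
      using \<alpha>(2) \<beta>(2) by (force simp: mem_Times_iff)
    then show ?thesis
      using that bounds(2) rectangle[OF that(1)] B by (auto simp: mem_Times_iff)
  qed
  have entries: "(fst (\<gamma> k), snd (\<gamma> l)) \<in> entries m n" if "k < glued_dim" "l < glued_dim" "nonzero k l" for k l
    using that in_A[of k l] in_B[of k l] by (auto simp: nonzero_def)
  have "(det glued :: 'a mpoly) \<in> Idl\<^bsub>poly_ring m n\<^esub> (minors_in m n r A)"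
    using entries in_A by (intro det_glued_in_Idl_rows) auto
  moreover have "(det glued :: 'a mpoly) \<in> Idl\<^bsub>poly_ring m n\<^esub> (minors_in m n s B)"
    using entries in_B' by (intro det_glued_in_Idl_columns) auto
  moreover have "Poly_Mapping.lookup (lead_monomial \<sigma> (det (glued :: 'a mpoly mat))) v \<le> Poly_Mapping.lookup t v"
    for v
  proof -
    have divides: "1 \<le> Poly_Mapping.lookup t v"
      if t: "t = (\<Sum>k<q. Poly_Mapping.single (f k) 1) + z" and v: "v \<in> f ` {..<q}"
      for f :: "nat \<Rightarrow> pos" and q z
    proof -
      obtain k where "k < q" "v = f k"
        using v by blast
      then have "1 \<le> (\<Sum>k<q. Poly_Mapping.lookup (Poly_Mapping.single (f k) (1::nat)) v)"
        by (intro order.trans[OF _ member_le_sum[of k]]) auto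
      then show ?thesis
        unfolding t by (simp add: lookup_add lookup_sum)
    qed
    show ?thesis
    proof (cases "v \<in> \<gamma> ` {..<glued_dim}")
      case True
      have "(\<Sum>k<glued_dim. Poly_Mapping.lookup (Poly_Mapping.single (\<gamma> k) (1::nat)) v) = 1"
      proof -
        obtain k where k: "k < glued_dim" "v = \<gamma> k"
          using True by blast
        have "(\<Sum>k<glued_dim. Poly_Mapping.lookup (Poly_Mapping.single (\<gamma> k) (1::nat)) v) =
            (\<Sum>l<glued_dim. if l = k then 1 else 0)"
          using k inj_on_\<gamma> by (intro sum.cong) (auto simp: lookup_single when_def inj_on_def)
        with k show ?thesis by simp
      qed
      moreover have "1 \<le> Poly_Mapping.lookup t v"
        using True \<gamma>_range divides[OF t\<alpha>] divides[OF t\<beta>] by blast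
      ultimately show ?thesis
        by (simp add: lead_monomial_det_glued lookup_sum)
    next
      case False
      then have "(\<Sum>k<glued_dim. Poly_Mapping.lookup (Poly_Mapping.single (\<gamma> k) (1::nat)) v) = 0"
        by (intro sum.neutral) (auto simp: lookup_single when_def)
      then show ?thesis
        by (simp add: lead_monomial_det_glued lookup_sum)
    qed
  qed
  ultimately show ?thesis
    using det_glued_nonzero poly_mapping_le_imp_diff by blast
qed

text \<open>A lower corner southeast of the last diagonal entry bounds the whole minor, because the
  ladder is closed towards its upper corner.\<close>

lemma minor_in_ladder:
  assumes corners: "lower_corners m n u L" and r: "1 \<le> r" and \<alpha>: "chain r \<alpha>"
    and ladder: "\<And>i j. i < r \<Longrightarrow> j < r \<Longrightarrow> (fst (\<alpha> i), snd (\<alpha> j)) \<in> one_sided_ladder u L"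
  obtains a b where "(a, b) \<in> set L"
    and "{fst u..a} \<times> {snd u..b} \<subseteq> one_sided_ladder u L \<inter> entries m n"
    and "\<And>i. i < r \<Longrightarrow> \<alpha> i \<in> {fst u..a} \<times> {snd u..b}"
proof -
  obtain a b where ab: "(a, b) \<in> set L" "fst (\<alpha> (r - 1)) \<le> a" "snd (\<alpha> (r - 1)) \<le> b"
    using ladder[of "r - 1" "r - 1"] r by (auto simp: one_sided_ladder_def)
  show thesis
  proof (rule that[OF ab(1)])
    show "{fst u..a} \<times> {snd u..b} \<subseteq> one_sided_ladder u L \<inter> entries m n"
      using corners ab(1) by (fastforce simp: lower_corners_def one_sided_ladder_def entries_def)
    show "\<alpha> i \<in> {fst u..a} \<times> {snd u..b}" if "i < r" for i
    proof -
      have "i \<le> r - 1" "r - 1 < r"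
        using that by auto
      then show ?thesis
        using ladder[OF that that] ab chain_leD[OF \<alpha>, of i "r - 1"]
        by (auto simp: one_sided_ladder_def mem_Times_iff)
    qed
  qed
qed

theorem corollary3p8:
  fixes m n k :: nat
    and B :: "nat \<Rightarrow> pos set" and r :: "nat \<Rightarrow> nat"
    and u :: pos and L :: "nat \<Rightarrow> pos list"
    and \<sigma> :: scan_order
  assumes "m \<le> n"
    and "\<And>i. i < k \<Longrightarrow> r i \<ge> 1"
    and "\<And>i. i < k \<Longrightarrow> lower_corners m n u (L i)"
    and "\<And>i. i < k \<Longrightarrow> B i = one_sided_ladder u (L i)"
    and "\<And>i j a b a' b'. i < k \<Longrightarrow> j < k \<Longrightarrow> i \<noteq> j \<Longrightarrow>
           (a, b) \<in> set (L i) \<Longrightarrow> (a', b') \<in> set (L j) \<Longrightarrow>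
           \<not> (a > a' \<and> b > b') \<and> \<not> (a < a' \<and> b < b')"
    and known: "\<And>i. i < k \<Longrightarrow>
           groebner_basis m n \<sigma> (minors_in m n (r i) (B i) :: 'a::field mpoly set)
             (Idl\<^bsub>poly_ring m n\<^esub> (minors_in m n (r i) (B i)))"
  shows "groebner_basis m n \<sigma> (\<Union>i<k. minors_in m n (r i) (B i) :: 'a mpoly set)
           (blockwise_determinantal_ideal m n k B r)"
  unfolding blockwise_determinantal_ideal_def
proof (rule groebner_basis_UN[OF known minors_in_carrier])
  fix i j :: nat and p q :: "'a mpoly" and t
  assume ij: "i < k" "j < k" "i \<noteq> j"
    and p: "p \<in> minors_in m n (r i) (B i)" and q: "q \<in> minors_in m n (r j) (B j)"
    and "\<exists>u. t = lead_monomial \<sigma> p + u" and "\<exists>u. t = lead_monomial \<sigma> q + u"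
  then obtain x y where t: "t = lead_monomial \<sigma> p + x" "t = lead_monomial \<sigma> q + y"
    by blast
  obtain \<alpha> where \<alpha>: "chain (r i) \<alpha>" "lead_monomial \<sigma> p = (\<Sum>k<r i. Poly_Mapping.single (\<alpha> k) 1)"
    and B\<alpha>: "\<And>i' j'. i' < r i \<Longrightarrow> j' < r i \<Longrightarrow> (fst (\<alpha> i'), snd (\<alpha> j')) \<in> B i"
    using minor_lead_monomial[OF p] by blast
  obtain \<beta> where \<beta>: "chain (r j) \<beta>" "lead_monomial \<sigma> q = (\<Sum>k<r j. Poly_Mapping.single (\<beta> k) 1)"
    and B\<beta>: "\<And>i' j'. i' < r j \<Longrightarrow> j' < r j \<Longrightarrow> (fst (\<beta> i'), snd (\<beta> j')) \<in> B j"
    using minor_lead_monomial[OF q] by blast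
  obtain a b where ab: "(a, b) \<in> set (L i)"
    "{fst u..a} \<times> {snd u..b} \<subseteq> B i \<inter> entries m n"
    "\<And>l. l < r i \<Longrightarrow> \<alpha> l \<in> {fst u..a} \<times> {snd u..b}"
    using minor_in_ladder[OF assms(3)[OF ij(1)] assms(2)[OF ij(1)] \<alpha>(1)] B\<alpha> assms(4)[OF ij(1)] by metis
  obtain a' b' where ab': "(a', b') \<in> set (L j)"
    "{fst u..a'} \<times> {snd u..b'} \<subseteq> B j \<inter> entries m n"
    "\<And>l. l < r j \<Longrightarrow> \<beta> l \<in> {fst u..a'} \<times> {snd u..b'}"
    using minor_in_ladder[OF assms(3)[OF ij(2)] assms(2)[OF ij(2)] \<beta>(1)] B\<beta> assms(4)[OF ij(2)] by metis
  note t\<alpha> = t(1)[unfolded \<alpha>(2)] and t\<beta> = t(2)[unfolded \<beta>(2)]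
  consider "a \<le> a'" "b' \<le> b" | "a' \<le> a" "b \<le> b'"
    using assms(5)[OF ij ab(1) ab'(1)] by linarith
  then show "\<exists>h \<in> Idl\<^bsub>poly_ring m n\<^esub> (minors_in m n (r i) (B i)) \<inter> Idl\<^bsub>poly_ring m n\<^esub> (minors_in m n (r j) (B j)).
      h \<noteq> 0 \<and> (\<exists>u. t = lead_monomial \<sigma> h + u)"
  proof cases
    case 1
    show ?thesis
      by (rule common_multiple_of_diagonals[OF \<alpha>(1) ab(3) \<beta>(1) ab'(3) 1 ab(2) ab'(2) t\<alpha> t\<beta>])
  next
    case 2
    show ?thesis
      unfolding Int_commute[of "Idl\<^bsub>poly_ring m n\<^esub> (minors_in m n (r i) (B i))"]
      by (rule common_multiple_of_diagonals[OF \<beta>(1) ab'(3) \<alpha>(1) ab(3) 2 ab'(2) ab(2) t\<beta> t\<alpha>])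
  qed
qed

end
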